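(* Let $C_n$ denote the cycle on $[n]$, $n\ge 3$, and let $J(C_n)\subset S=K[x_1,\ldots,x_n]$ be its vertex cover ideal over a field $K$. Let $i$ be the projective dimension of $J(C_n)$ and $j$ the (Castelnuovo–Mumford) regularity of $J(C_n)$. Let $k\ge 1$ be an integer. Then: (i) if $n=3k$, then $i=k$, $j=2k$ and $\beta_{k,k+2k}(J(C_{3k}))=2$; (ii) if $n=3k+1$, then $i=k$, $j=2k+1$ and $\beta_{k,k+(2k+1)}(J(C_{3k+1}))=1$; (iii) if $n=3k+2$, then $i=k+1$, $j=2k+1$ and $\beta_{k+1,(k+1)+(2k+1)}(J(C_{3k+2}))=1$.
   Context: $C_n$ is the graph on the vertex set $[n]=\{1,\ldots,n\}$ with edge set $\{\{1,2\},\{2,3\},\ldots,\{n-1,n\},\{1,n\}\}$. A vertex cover of a graph on $[n]$ is a set $W\subset[n]$ meeting every edge. The vertex cover ideal $J(G)$ of a graph $G$ on $[n]$ is the ideal of $S=K[x_1,\ldots,x_n]$ generated by the monomials $\prod_{a\in W}x_a$ with $W$ a minimal (under inclusion) vertex cover of $G$. Projective dimension, regularity and graded Betti numbers $\beta_{p,q}(J(G))=\dim_K\mathrm{Tor}^S_p(J(G),K)_q$ are those of the ideal $J(G)$ itself, regarded as a graded $S$-module with the standard grading (not of $S/J(G)$). *)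

theory Defs
  imports
    Complex_Main
    "HOL-Library.Poly_Mapping"
    "HOL-Library.Function_Algebras"
    "HOL-Algebra.Ideal"
begin

section \<open>The standard graded polynomial ring\<close>

text \<open>
  An exponent vector is a finitely supported map from variable indices to exponents, and a
  polynomial is a finitely supported map from exponent vectors to coefficients.  The ring
  $S = K[x_1,\ldots,x_n]$ consists of the polynomials that use only the variables with index
  in \<open>{1..n}\<close>.
\<close>

type_synonym 'k mpoly = "(nat \<Rightarrow>\<^sub>0 nat) \<Rightarrow>\<^sub>0 'k"

definition poly_ring :: "nat \<Rightarrow> ('k::field) mpoly ring" where
  "poly_ring n =
     \<lparr>carrier = {f. \<forall>m\<in>Poly_Mapping.keys f. Poly_Mapping.keys m \<subseteq> {1..n}},
      mult = (*), one = 1, zero = 0, add = (+)\<rparr>"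

definition var :: "nat \<Rightarrow> ('k::field) mpoly" where
  "var a = Poly_Mapping.single (Poly_Mapping.single a 1) 1"

definition monomial_degree :: "(nat \<Rightarrow>\<^sub>0 nat) \<Rightarrow> nat" where
  "monomial_degree m = (\<Sum>a\<in>Poly_Mapping.keys m. Poly_Mapping.lookup m a)"

text \<open>The zero polynomial is homogeneous of every degree, and it is the only homogeneous
  polynomial of negative degree.\<close>

definition homogeneous :: "('k::field) mpoly \<Rightarrow> int \<Rightarrow> bool" where
  "homogeneous f d \<longleftrightarrow> (\<forall>m\<in>Poly_Mapping.keys f. int (monomial_degree m) = d)"

definition const_coeff :: "('k::field) mpoly \<Rightarrow> 'k" where
  "const_coeff f = Poly_Mapping.lookup f 0"

section \<open>Vertex cover ideals\<close>

definition cycle_edges :: "nat \<Rightarrow> nat set set" where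
  "cycle_edges n = {{a, Suc a} |a. 1 \<le> a \<and> a < n} \<union> {{1, n}}"

definition vertex_cover :: "nat \<Rightarrow> nat set set \<Rightarrow> nat set \<Rightarrow> bool" where
  "vertex_cover n E W \<longleftrightarrow> W \<subseteq> {1..n} \<and> (\<forall>e\<in>E. W \<inter> e \<noteq> {})"

definition minimal_vertex_cover :: "nat \<Rightarrow> nat set set \<Rightarrow> nat set \<Rightarrow> bool" where
  "minimal_vertex_cover n E W \<longleftrightarrow>
     vertex_cover n E W \<and> (\<forall>W'. vertex_cover n E W' \<and> W' \<subseteq> W \<longrightarrow> W' = W)"

definition cover_ideal :: "nat \<Rightarrow> nat set set \<Rightarrow> ('k::field) mpoly set" where
  "cover_ideal n E =
     genideal (poly_ring n) {\<Prod>a\<in>W. var a |W. minimal_vertex_cover n E W}"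

section \<open>Graded free resolutions\<close>

text \<open>
  A sequence of graded free modules $F_p = \bigoplus_{i < r_p} S(-d_{p,i})$ of finite rank,
  with homomorphisms $F_{p+1} \to F_p$ given by matrices and an augmentation $F_0 \to S$.
  The fields are: \<open>rk p\<close> the rank $r_p$, \<open>shift p i\<close> the degree $d_{p,i}$ of the \<open>i\<close>-th basis
  element of $F_p$, \<open>bdry p\<close> the matrix (row index first) of $F_{p+1} \to F_p$, and \<open>aug i\<close> the
  image in $S$ of the \<open>i\<close>-th basis element of $F_0$.  Entries beyond the ranks are irrelevant.
\<close>

record 'r free_complex =
  rk :: "nat \<Rightarrow> nat"
  shift :: "nat \<Rightarrow> nat \<Rightarrow> int"
  bdry :: "nat \<Rightarrow> nat \<Rightarrow> nat \<Rightarrow> 'r"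
  aug :: "nat \<Rightarrow> 'r"

text \<open>A vector of length \<open>r\<close> is a function that vanishes from index \<open>r\<close> on.\<close>

definition free_module :: "nat \<Rightarrow> nat \<Rightarrow> (nat \<Rightarrow> ('k::field) mpoly) set" where
  "free_module n r = {v. (\<forall>i<r. v i \<in> carrier (poly_ring n)) \<and> (\<forall>i\<ge>r. v i = 0)}"

definition mat_apply ::
    "nat \<Rightarrow> nat \<Rightarrow> (nat \<Rightarrow> nat \<Rightarrow> 'r) \<Rightarrow> (nat \<Rightarrow> 'r) \<Rightarrow> nat \<Rightarrow> ('r::comm_ring_1)" where
  "mat_apply r s A v = (\<lambda>i. if i < r then \<Sum>j<s. A i j * v j else 0)"

definition aug_apply :: "('k::field) mpoly free_complex \<Rightarrow> (nat \<Rightarrow> 'k mpoly) \<Rightarrow> 'k mpoly" where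
  "aug_apply F v = (\<Sum>i<rk F 0. v i * aug F i)"

definition bdry_apply ::
    "('k::field) mpoly free_complex \<Rightarrow> nat \<Rightarrow> (nat \<Rightarrow> 'k mpoly) \<Rightarrow> nat \<Rightarrow> 'k mpoly" where
  "bdry_apply F p = mat_apply (rk F p) (rk F (Suc p)) (bdry F p)"

text \<open>\<open>F\<close> is a graded free resolution of the homogeneous ideal \<open>J\<close>, i.e. the complex
  $\cdots \to F_1 \to F_0 \to J \to 0$ of graded modules and maps of degree 0 is exact.\<close>

definition graded_free_resolution ::
    "nat \<Rightarrow> ('k::field) mpoly set \<Rightarrow> 'k mpoly free_complex \<Rightarrow> bool" where
  "graded_free_resolution n J F \<longleftrightarrow>
     (\<forall>i<rk F 0. aug F i \<in> carrier (poly_ring n) \<and> homogeneous (aug F i) (shift F 0 i)) \<and>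
     (\<forall>p. \<forall>i<rk F p. \<forall>j<rk F (Suc p).
        bdry F p i j \<in> carrier (poly_ring n) \<and>
        homogeneous (bdry F p i j) (shift F (Suc p) j - shift F p i)) \<and>
     aug_apply F ` free_module n (rk F 0) = J \<and>
     {v \<in> free_module n (rk F 0). aug_apply F v = 0}
       = bdry_apply F 0 ` free_module n (rk F 1) \<and>
     (\<forall>p. {v \<in> free_module n (rk F (Suc p)). bdry_apply F p v = 0}
       = bdry_apply F (Suc p) ` free_module n (rk F (Suc (Suc p))))"

section \<open>Tor, graded Betti numbers, projective dimension and regularity\<close>

text \<open>
  Here $K = S/(x_1,\ldots,x_n)$, so $(F_p \otimes_S K)_q$ is the $K$-vector space on the basis
  elements of $F_p$ of degree \<open>q\<close>, and the maps of $F \otimes_S K$ are given by the constant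
  coefficients of the matrix entries.
\<close>

definition strand :: "('k::field) mpoly free_complex \<Rightarrow> nat \<Rightarrow> int \<Rightarrow> (nat \<Rightarrow> 'k) set" where
  "strand F p q = {v. \<forall>i. v i \<noteq> 0 \<longrightarrow> i < rk F p \<and> shift F p i = q}"

definition bdry_tensor ::
    "('k::field) mpoly free_complex \<Rightarrow> nat \<Rightarrow> (nat \<Rightarrow> 'k) \<Rightarrow> nat \<Rightarrow> 'k" where
  "bdry_tensor F p =
     mat_apply (rk F p) (rk F (Suc p)) (\<lambda>i j. const_coeff (bdry F p i j))"

fun tor_cycles :: "('k::field) mpoly free_complex \<Rightarrow> nat \<Rightarrow> int \<Rightarrow> (nat \<Rightarrow> 'k) set" where
  "tor_cycles F 0 q = strand F 0 q"
| "tor_cycles F (Suc p) q = {v \<in> strand F (Suc p) q. bdry_tensor F p v = 0}"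

definition tor_boundaries ::
    "('k::field) mpoly free_complex \<Rightarrow> nat \<Rightarrow> int \<Rightarrow> (nat \<Rightarrow> 'k) set" where
  "tor_boundaries F p q = bdry_tensor F p ` strand F (Suc p) q"

definition vec_dim :: "(nat \<Rightarrow> 'k::field) set \<Rightarrow> nat" where
  "vec_dim V = vector_space.dim (\<lambda>(c::'k) v i. c * v i) V"

text \<open>
  $\beta_{p,q}(J) = \dim_K \mathrm{Tor}^S_p(J,K)_q$, where Tor is the homology of $F \otimes_S K$
  for a graded free resolution \<open>F\<close> of \<open>J\<close>; the value does not depend on the choice of \<open>F\<close>.  The
  boundaries form a subspace of the finite-dimensional space of cycles, so the truncated
  subtraction is the dimension of the quotient.
\<close>

definition betti :: "nat \<Rightarrow> ('k::field) mpoly set \<Rightarrow> nat \<Rightarrow> int \<Rightarrow> nat" where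
  "betti n J p q =
     (let F = SOME F. graded_free_resolution n J F
      in vec_dim (tor_cycles F p q) - vec_dim (tor_boundaries F p q))"

text \<open>The projective dimension is the least length of a graded free resolution; finitely
  generated graded projective \<open>S\<close>-modules are free.\<close>

definition proj_dim :: "nat \<Rightarrow> ('k::field) mpoly set \<Rightarrow> nat" where
  "proj_dim n J =
     (LEAST l. \<exists>F. graded_free_resolution n J F \<and> (\<forall>p>l. rk F p = 0))"

definition regularity :: "nat \<Rightarrow> ('k::field) mpoly set \<Rightarrow> int" where
  "regularity n J = Max {q - int p |p q. betti n J p q \<noteq> 0}"

end

(*
  Splitting the vertex covers of a graph according to whether they contain a vertex x or
  all of its neighbours N gives J(G) = x J(G - x) + x_N J(G - N[x]), and the two summands
  intersect in x x_N J(G - N[x]).  The mapping cone of the corresponding exact sequence turns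
  resolutions for the smaller graphs into one for G.  Iterating this on paths and applying it
  once to the cycle bounds all degrees that occur; in degree n the resulting (in general
  non-minimal) resolution of J(C_n) lives in a single homological position, so nothing cancels
  there and the extremal Betti number can be read off from the rank.  Homotopy uniqueness of
  graded resolutions transfers this to the resolution chosen in the definition of Tor.
*)

theory Submission
  imports Defs
begin

section \<open>Supports and homogeneous components of polynomials\<close>

text \<open>The definitions fix no resolution: Betti numbers come from a \<open>SOME\<close>-choice,
  so an explicit resolution serves twice, to show that the choice is a resolution at all and,
  through homotopy uniqueness, to compute with it. The cones are not minimal, so ranks only bound
  Betti numbers from above; exact values are available where the two neighbouring positions are
  empty in the same degree. What makes one degree sufficient is a coincidence of bounds. The ranks
  for C_n vanish unless 3 p <= n + 1, 3 (q - p) <= 2 n + 1 and q <= n. With l the floor of (n + 1) /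
  3 and r the floor of (2 n + 1) / 3 one has l + r = n, so basis elements of degree n in position l
  are extremal in all three respects: the same nonzero Betti number forces projective dimension l
  and regularity r. The dependence on n modulo 3 stems from the paths: in the recursion only the
  intersection term, which loses three vertices, can reach the degree that equals the number of
  vertices.\<close>

definition supp_in :: "(nat \<Rightarrow>\<^sub>0 nat) set \<Rightarrow> ('k::field) mpoly set" where
  "supp_in P = {f. Poly_Mapping.keys f \<subseteq> P}"

text \<open>Projection that keeps the monomials in \<open>P\<close>. It is additive but in general
  not \<open>S\<close>-linear; homogeneous components, constant terms and the splitting of a sum of
  monomial ideals are all instances.\<close>

definition restr :: "(nat \<Rightarrow>\<^sub>0 nat) set \<Rightarrow> ('k::field) mpoly \<Rightarrow> 'k mpoly" where
  "restr P f = (\<Sum>m\<in>Poly_Mapping.keys f \<inter> P. Poly_Mapping.single m (Poly_Mapping.lookup f m))"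

lemma supp_in_0 [simp]: "0 \<in> supp_in P"
  by (simp add: supp_in_def)

lemma supp_in_add: "f \<in> supp_in P \<Longrightarrow> g \<in> supp_in P \<Longrightarrow> f + g \<in> supp_in P"
  unfolding supp_in_def using Poly_Mapping.keys_add[of f g] by blast

lemma supp_in_uminus [simp]: "- f \<in> supp_in P \<longleftrightarrow> f \<in> supp_in P"
  by (simp add: supp_in_def)

lemma supp_in_sum: "(\<And>i. i \<in> A \<Longrightarrow> f i \<in> supp_in P) \<Longrightarrow> sum f A \<in> supp_in P"
  by (induction A rule: infinite_finite_induct) (auto intro: supp_in_add)

text \<open>\<open>S\<close>, the homogeneous polynomials of a fixed degree and the monomial ideals
  are all of the form \<open>supp_in P\<close>, so each of their closure laws under products reduces
  to this fact about exponent vectors.\<close>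

lemma supp_in_mult:
  assumes "f \<in> supp_in P" "g \<in> supp_in Q" "\<And>a b. a \<in> P \<Longrightarrow> b \<in> Q \<Longrightarrow> a + b \<in> R"
  shows "f * g \<in> supp_in R"
  using assms keys_mult[of f g] unfolding supp_in_def by fastforce

lemma supp_in_single [simp]: "Poly_Mapping.single m c \<in> supp_in P \<longleftrightarrow> c = 0 \<or> m \<in> P"
  by (simp add: supp_in_def)

lemma supp_in_one [simp]: "1 \<in> supp_in P \<longleftrightarrow> 0 \<in> P"
  by (simp add: supp_in_def)

lemma supp_in_mono: "f \<in> supp_in P \<Longrightarrow> P \<subseteq> Q \<Longrightarrow> f \<in> supp_in Q"
  by (auto simp: supp_in_def)

lemma lookup_restr:
  "Poly_Mapping.lookup (restr P f) m = (if m \<in> P then Poly_Mapping.lookup f m else 0)"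
  unfolding restr_def lookup_sum lookup_single
  by (auto simp: when_def sum.delta' in_keys_iff)

lemma keys_restr: "Poly_Mapping.keys (restr P f) = Poly_Mapping.keys f \<inter> P"
  by (auto simp: in_keys_iff lookup_restr split: if_splits)

lemma restr_supp_in: "restr P f \<in> supp_in P"
  by (auto simp: supp_in_def keys_restr)

lemma restr_supp_in': "f \<in> supp_in Q \<Longrightarrow> restr P f \<in> supp_in Q"
  by (auto simp: supp_in_def keys_restr)

lemma restr_add: "restr P (f + g) = restr P f + restr P g"
  by (rule poly_mapping_eqI) (simp add: lookup_restr lookup_add)

lemma restr_0 [simp]: "restr P 0 = 0"
  by (rule poly_mapping_eqI) (simp add: lookup_restr)

lemma restr_sum: "restr P (sum f A) = (\<Sum>i\<in>A. restr P (f i))"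
  by (induction A rule: infinite_finite_induct) (auto simp: restr_add)

lemma restr_id: "f \<in> supp_in P \<Longrightarrow> restr P f = f"
  by (rule poly_mapping_eqI) (auto simp: lookup_restr supp_in_def in_keys_iff subset_iff)

lemma restr_eq_0: "f \<in> supp_in (- P) \<Longrightarrow> restr P f = 0"
  by (rule poly_mapping_eqI) (auto simp: lookup_restr supp_in_def in_keys_iff subset_iff)

lemma restr_split: "f = restr P f + restr (- P) f"
  by (rule poly_mapping_eqI) (auto simp: lookup_restr lookup_add)

lemma poly_expand:
  fixes f :: "('k::field) mpoly"
  shows "f = (\<Sum>m\<in>Poly_Mapping.keys f. Poly_Mapping.single m (Poly_Mapping.lookup f m))"
  using restr_id[of f UNIV] by (simp add: restr_def supp_in_def)

lemma keys_add_nat: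
  fixes a b :: "'a \<Rightarrow>\<^sub>0 nat"
  shows "Poly_Mapping.keys (a + b) = Poly_Mapping.keys a \<union> Poly_Mapping.keys b"
  by (auto simp: in_keys_iff lookup_add)

section \<open>The polynomial ring in terms of supports\<close>

abbreviation pcarrier :: "nat \<Rightarrow> ('k::field) mpoly set" where
  "pcarrier n \<equiv> carrier (poly_ring n)"

lemma pcarrier_eq: "pcarrier n = supp_in {m. Poly_Mapping.keys m \<subseteq> {1..n}}"
  by (auto simp: poly_ring_def supp_in_def)

lemma pcarrier_0 [simp]: "0 \<in> pcarrier n"
  by (simp add: pcarrier_eq)

lemma pcarrier_1 [simp]: "1 \<in> pcarrier n"
  by (simp add: pcarrier_eq)

lemma pcarrier_add: "f \<in> pcarrier n \<Longrightarrow> g \<in> pcarrier n \<Longrightarrow> f + g \<in> pcarrier n"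
  unfolding pcarrier_eq by (rule supp_in_add)

lemma pcarrier_uminus: "f \<in> pcarrier n \<Longrightarrow> - f \<in> pcarrier n"
  unfolding pcarrier_eq by simp

lemma pcarrier_mult: "f \<in> pcarrier n \<Longrightarrow> g \<in> pcarrier n \<Longrightarrow> f * g \<in> pcarrier n"
  unfolding pcarrier_eq by (rule supp_in_mult) (auto simp: keys_add_nat)

lemma pcarrier_sum: "(\<And>i. i \<in> A \<Longrightarrow> f i \<in> pcarrier n) \<Longrightarrow> sum f A \<in> pcarrier n"
  unfolding pcarrier_eq by (rule supp_in_sum)

lemma pcarrier_const [simp]: "Poly_Mapping.single 0 c \<in> pcarrier n"
  unfolding pcarrier_eq by simp

section \<open>Degrees and homogeneous components\<close>

lemma monomial_degree_superset:
  "finite A \<Longrightarrow> Poly_Mapping.keys m \<subseteq> A \<Longrightarrow> monomial_degree m = (\<Sum>a\<in>A. Poly_Mapping.lookup m a)"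
  unfolding monomial_degree_def by (rule sum.mono_neutral_left) (auto simp: in_keys_iff)

lemma monomial_degree_add: "monomial_degree (a + b) = monomial_degree a + monomial_degree b"
  using monomial_degree_superset[of "Poly_Mapping.keys a \<union> Poly_Mapping.keys b"]
  by (simp add: keys_add_nat lookup_add sum.distrib)

lemma monomial_degree_0 [simp]: "monomial_degree 0 = 0"
  by (simp add: monomial_degree_def)

lemma homogeneous_eq: "homogeneous f d \<longleftrightarrow> f \<in> supp_in {m. int (monomial_degree m) = d}"
  by (auto simp: homogeneous_def supp_in_def)

lemma homogeneous_0 [simp]: "homogeneous 0 d"
  by (simp add: homogeneous_eq)

lemma homogeneous_1: "homogeneous 1 0"
  by (simp add: homogeneous_eq)

lemma homogeneous_add: "homogeneous f d \<Longrightarrow> homogeneous g d \<Longrightarrow> homogeneous (f + g) d"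
  unfolding homogeneous_eq by (rule supp_in_add)

lemma homogeneous_uminus: "homogeneous f d \<Longrightarrow> homogeneous (- f) d"
  unfolding homogeneous_eq by simp

lemma homogeneous_sum:
  "(\<And>i. i \<in> A \<Longrightarrow> homogeneous (f i) d) \<Longrightarrow> homogeneous (sum f A) d"
  unfolding homogeneous_eq by (rule supp_in_sum)

lemma homogeneous_mult:
  "homogeneous f d \<Longrightarrow> homogeneous g e \<Longrightarrow> homogeneous (f * g) (d + e)"
  unfolding homogeneous_eq by (rule supp_in_mult) (auto simp: monomial_degree_add)

definition hom_comp :: "int \<Rightarrow> ('k::field) mpoly \<Rightarrow> 'k mpoly" where
  "hom_comp d = restr {m. int (monomial_degree m) = d}"

lemma hom_comp_homogeneous: "homogeneous (hom_comp d f) d"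
  by (simp add: hom_comp_def homogeneous_eq restr_supp_in)

lemma hom_comp_pcarrier: "f \<in> pcarrier n \<Longrightarrow> hom_comp d f \<in> pcarrier n"
  by (simp add: hom_comp_def pcarrier_eq restr_supp_in')

lemma hom_comp_id: "homogeneous f d \<Longrightarrow> hom_comp d f = f"
  by (simp add: hom_comp_def homogeneous_eq restr_id)

lemma hom_comp_0 [simp]: "hom_comp d 0 = 0"
  by (simp add: hom_comp_def)

lemma hom_comp_sum: "hom_comp d (sum f A) = (\<Sum>i\<in>A. hom_comp d (f i))"
  by (simp add: hom_comp_def restr_sum)

text \<open>Degrees add, so multiplying by \<open>f\<close> sends the part of \<open>g\<close>
  outside degree \<open>d - e\<close> to monomials outside degree \<open>d\<close>. This lets a
  homogeneous matrix act on homogeneous components.\<close>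

lemma hom_comp_mult:
  assumes f: "homogeneous f e"
  shows "hom_comp d (f * g) = f * hom_comp (d - e) g"
proof -
  let ?D = "\<lambda>d. {m. int (monomial_degree m) = d}"
  have 1: "hom_comp d (f * hom_comp (d - e) g) = f * hom_comp (d - e) g"
    using homogeneous_mult[OF f hom_comp_homogeneous[of "d - e" g]] by (intro hom_comp_id) simp
  have "f * restr (- ?D (d - e)) g \<in> supp_in (- ?D d)"
    by (rule supp_in_mult[OF f[unfolded homogeneous_eq] restr_supp_in])
       (auto simp: monomial_degree_add)
  then have 2: "hom_comp d (f * restr (- ?D (d - e)) g) = 0"
    unfolding hom_comp_def by (rule restr_eq_0)
  have "f * g = f * hom_comp (d - e) g + f * restr (- ?D (d - e)) g"
    unfolding hom_comp_def distrib_left[symmetric] by (simp flip: restr_split)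
  then have "hom_comp d (f * g) = hom_comp d (f * hom_comp (d - e) g) + hom_comp d (f * restr (- ?D (d - e)) g)"
    by (simp add: hom_comp_def restr_add)
  then show ?thesis using 1 2 by simp
qed

section \<open>Constant coefficients\<close>

lemma const_coeff_0 [simp]: "const_coeff 0 = 0"
  by (simp add: const_coeff_def)

lemma const_coeff_add: "const_coeff (f + g) = const_coeff f + const_coeff g"
  by (simp add: const_coeff_def lookup_add)

lemma const_coeff_diff: "const_coeff (f - g) = const_coeff f - const_coeff g"
  by (simp add: const_coeff_def lookup_minus)

lemma const_coeff_sum: "const_coeff (sum f A) = (\<Sum>i\<in>A. const_coeff (f i))"
  by (simp add: const_coeff_def lookup_sum)

lemma const_coeff_single [simp]: "const_coeff (Poly_Mapping.single 0 c) = c"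
  by (simp add: const_coeff_def)

text \<open>Exponents are natural numbers, so a sum of two exponent vectors is 0 only when both are,
  and a product involving a nonconstant monomial has no constant term. Taking constant coefficients
  is thus a ring homomorphism, the reduction modulo the irrelevant ideal.\<close>

lemma const_coeff_mult: "const_coeff (f * g) = const_coeff f * const_coeff g"
proof -
  let ?Z = "- {0 :: nat \<Rightarrow>\<^sub>0 nat}"
  let ?c = "\<lambda>f. Poly_Mapping.single 0 (const_coeff f)"
  have c: "restr {0} f = ?c f" for f :: "'a mpoly"
    by (rule poly_mapping_eqI) (auto simp: lookup_restr lookup_single const_coeff_def when_def)
  have z: "const_coeff h = 0" if "h \<in> supp_in ?Z" for h :: "'a mpoly"
    using that by (auto simp: supp_in_def const_coeff_def in_keys_iff)
  have nz: "a + b \<in> ?Z" if "a \<in> ?Z \<or> b \<in> ?Z" for a b :: "nat \<Rightarrow>\<^sub>0 nat"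
    using that keys_add_nat[of a b] by (auto simp flip: keys_eq_empty)
  have "f * g = (?c f + restr ?Z f) * (?c g + restr ?Z g)"
    by (simp flip: c add: restr_split[symmetric])
  also have "\<dots> = ?c f * ?c g + (?c f * restr ?Z g + restr ?Z f * (?c g + restr ?Z g))"
    by (simp add: algebra_simps)
  finally have "const_coeff (f * g) = const_coeff (?c f * ?c g)
      + const_coeff (?c f * restr ?Z g + restr ?Z f * (?c g + restr ?Z g))"
    by (simp add: const_coeff_add)
  moreover have "?c f * restr ?Z g + restr ?Z f * (?c g + restr ?Z g) \<in> supp_in ?Z"
    by (intro supp_in_add supp_in_mult[of _ UNIV _ ?Z] supp_in_mult[of _ ?Z _ UNIV] restr_supp_in nz)
       (auto simp: supp_in_def)
  ultimately show ?thesis using z by (simp add: mult_single)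
qed

section \<open>Graded linear maps\<close>

definition unitv :: "nat \<Rightarrow> nat \<Rightarrow> 'r::zero_neq_one" where
  "unitv j = (\<lambda>i. if i = j then 1 else 0)"

definition scal :: "'r::times \<Rightarrow> (nat \<Rightarrow> 'r) \<Rightarrow> nat \<Rightarrow> 'r" where
  "scal c v = (\<lambda>i. c * v i)"

lemma scal_0 [simp]: "scal c 0 = (0 :: nat \<Rightarrow> 'r::comm_ring_1)"
  by (auto simp: scal_def)

lemma scal_add: "scal c (u + v) = scal c u + (scal c v :: nat \<Rightarrow> 'r::comm_ring_1)"
  by (auto simp: scal_def distrib_left)

lemma scal_uminus: "scal c (- v) = - (scal c v :: nat \<Rightarrow> 'r::comm_ring_1)"
  by (auto simp: scal_def)

text \<open>Homogeneity of degree \<open>q\<close> in the direct sum of the modules S(-d_i). The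
  quantifier has no rank bound because entries beyond the rank are 0, which is homogeneous of every
  degree.\<close>

definition hvec :: "(nat \<Rightarrow> int) \<Rightarrow> int \<Rightarrow> (nat \<Rightarrow> ('k::field) mpoly) \<Rightarrow> bool" where
  "hvec d q v \<longleftrightarrow> (\<forall>i. homogeneous (v i) (q - d i))"

text \<open>Degree-preserving \<open>S\<close>-linear maps from $\bigoplus_{i<s} S(-d_i)$ to
  $\bigoplus_{i<r} S(-e_i)$.\<close>

definition glin :: "nat \<Rightarrow> nat \<Rightarrow> (nat \<Rightarrow> int) \<Rightarrow> nat \<Rightarrow> (nat \<Rightarrow> int) \<Rightarrow>
    ((nat \<Rightarrow> ('k::field) mpoly) \<Rightarrow> nat \<Rightarrow> 'k mpoly) \<Rightarrow> bool" where
  "glin n s d r e f \<longleftrightarrow>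
     (\<forall>v\<in>free_module n s. f v \<in> free_module n r) \<and>
     (\<forall>u\<in>free_module n s. \<forall>v\<in>free_module n s. f (u + v) = f u + f v) \<and>
     (\<forall>c\<in>pcarrier n. \<forall>v\<in>free_module n s. f (scal c v) = scal c (f v)) \<and>
     (\<forall>q. \<forall>v\<in>free_module n s. hvec d q v \<longrightarrow> hvec e q (f v))"

lemma free_module_0 [simp]: "0 \<in> free_module n s"
  by (simp add: free_module_def)

lemma free_module_zero_rank: "v \<in> free_module n 0 \<longleftrightarrow> v = 0"
  by (auto simp: free_module_def)

lemma free_module_add: "u \<in> free_module n s \<Longrightarrow> v \<in> free_module n s \<Longrightarrow> u + v \<in> free_module n s"
  by (auto simp: free_module_def pcarrier_add)

lemma free_module_uminus: "u \<in> free_module n s \<Longrightarrow> - u \<in> free_module n s"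
  by (auto simp: free_module_def pcarrier_uminus)

lemma free_module_diff: "u \<in> free_module n s \<Longrightarrow> v \<in> free_module n s \<Longrightarrow> u - v \<in> free_module n s"
  using free_module_add[of u n s "- v"] free_module_uminus[of v] by simp

lemma free_module_scal: "c \<in> pcarrier n \<Longrightarrow> v \<in> free_module n s \<Longrightarrow> scal c v \<in> free_module n s"
  by (auto simp: free_module_def scal_def pcarrier_mult)

lemma free_module_pcarrier: "v \<in> free_module n s \<Longrightarrow> v i \<in> pcarrier n"
  by (cases "i < s") (auto simp: free_module_def)

lemma free_module_unitv: "j < s \<Longrightarrow> unitv j \<in> free_module n s"
  by (auto simp: free_module_def unitv_def)

lemma free_module_sum:
  "(\<And>j. j \<in> A \<Longrightarrow> f j \<in> free_module n s) \<Longrightarrow> sum f A \<in> free_module n s"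
  by (induction A rule: infinite_finite_induct) (auto simp: free_module_add)

lemma sum_fun_at: "sum f A i = (\<Sum>j\<in>A. f j i)"
  by (induction A rule: infinite_finite_induct) auto

lemma free_module_expand:
  assumes "v \<in> free_module n s"
  shows "v = (\<Sum>j<s. scal (v j) (unitv j))"
proof
  fix i
  have "(\<Sum>j<s. scal (v j) (unitv j)) i = (\<Sum>j<s. if i = j then v j else 0)"
    unfolding sum_fun_at scal_def unitv_def by (rule sum.cong) auto
  also have "\<dots> = v i"
    using assms by (auto simp: free_module_def)
  finally show "v i = (\<Sum>j<s. scal (v j) (unitv j)) i" ..
qed

lemma hvec_0 [simp]: "hvec d q 0"
  by (simp add: hvec_def)

lemma hvec_add: "hvec d q u \<Longrightarrow> hvec d q v \<Longrightarrow> hvec d q (u + v)"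
  by (simp add: hvec_def homogeneous_add)

lemma hvec_uminus: "hvec d q u \<Longrightarrow> hvec d q (- u)"
  by (simp add: hvec_def homogeneous_uminus)

lemma hvec_unitv: "hvec d (d j) (unitv j)"
  by (auto simp: hvec_def unitv_def homogeneous_1)

lemma glin_FM: "glin n s d r e f \<Longrightarrow> v \<in> free_module n s \<Longrightarrow> f v \<in> free_module n r"
  by (simp add: glin_def)

lemma glin_add:
  "glin n s d r e f \<Longrightarrow> u \<in> free_module n s \<Longrightarrow> v \<in> free_module n s \<Longrightarrow> f (u + v) = f u + f v"
  by (simp add: glin_def)

lemma glin_scal:
  "glin n s d r e f \<Longrightarrow> c \<in> pcarrier n \<Longrightarrow> v \<in> free_module n s \<Longrightarrow> f (scal c v) = scal c (f v)"
  by (simp add: glin_def)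

lemma glin_hvec:
  "glin n s d r e f \<Longrightarrow> v \<in> free_module n s \<Longrightarrow> hvec d q v \<Longrightarrow> hvec e q (f v)"
  by (simp add: glin_def)

lemma glin_0:
  assumes "glin n s d r e f"
  shows "f 0 = 0"
proof -
  have "f (0 + 0) = f 0 + f 0"
    by (rule glin_add[OF assms]) simp_all
  then show ?thesis by simp
qed

lemma glin_uminus:
  assumes "glin n s d r e f" "v \<in> free_module n s"
  shows "f (- v) = - f v"
proof -
  have "f v + f (- v) = f (v + - v)"
    by (rule glin_add[OF assms(1), symmetric]) (simp_all add: assms free_module_uminus)
  then have "f v + f (- v) = 0"
    by (simp add: glin_0[OF assms(1)])
  then show ?thesis by (simp add: eq_neg_iff_add_eq_0 add.commute)
qed

lemma glin_diff:
  assumes "glin n s d r e f" "u \<in> free_module n s" "v \<in> free_module n s"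
  shows "f (u - v) = f u - f v"
  using glin_add[OF assms(1,2) free_module_uminus[OF assms(3)]]
  by (simp add: glin_uminus[OF assms(1,3)])

lemma glin_sum:
  assumes f: "glin n s d r e f" and "\<And>j. j \<in> A \<Longrightarrow> v j \<in> free_module n s"
  shows "f (sum v A) = (\<Sum>j\<in>A. f (v j))"
  using assms(2)
  by (induction A rule: infinite_finite_induct)
     (auto simp: glin_0[OF f] glin_add[OF f] free_module_sum)

text \<open>Graded maps are plain functions, constrained only on the free module, so that composites
  and cones are easy to form. This recovers their matrix, with column \<open>j\<close> given by the
  value at \<open>unitv j\<close>.\<close>

lemma glin_expand:
  assumes f: "glin n s d r e f" and v: "v \<in> free_module n s"
  shows "f v i = (\<Sum>j<s. v j * f (unitv j) i)"
proof -
  have "f v = f (\<Sum>j<s. scal (v j) (unitv j))"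
    using free_module_expand[OF v] by simp
  also have "\<dots> = (\<Sum>j<s. f (scal (v j) (unitv j)))"
    by (rule glin_sum[OF f])
       (simp add: free_module_scal free_module_unitv free_module_pcarrier[OF v])
  also have "\<dots> = (\<Sum>j<s. scal (v j) (f (unitv j)))"
    by (intro sum.cong refl glin_scal[OF f])
       (simp_all add: free_module_unitv free_module_pcarrier[OF v])
  finally show ?thesis by (simp add: sum_fun_at scal_def)
qed

lemma glin_ext:
  assumes "glin n s d r e f" "glin n s d' r' e' g" "v \<in> free_module n s"
    and "\<And>j. j < s \<Longrightarrow> f (unitv j) = g (unitv j)"
  shows "f v = g v"
proof
  fix i
  show "f v i = g v i"
    unfolding glin_expand[OF assms(1,3)] glin_expand[OF assms(2,3)] using assms(4) by simp
qed

lemma glin_id: "glin n s d s d (\<lambda>v. v)"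
  by (simp add: glin_def)

lemma glin_zero_map: "glin n s d r e (\<lambda>v. 0)"
  by (simp add: glin_def)

lemma glin_comp:
  assumes "glin n s d r e f" "glin n r e t h g"
  shows "glin n s d t h (\<lambda>v. g (f v))"
  using assms by (simp add: glin_def)

lemma glin_plus:
  assumes "glin n s d r e f" "glin n s d r e g"
  shows "glin n s d r e (\<lambda>v. f v + g v)"
  using assms
  by (auto simp: glin_def free_module_add hvec_add scal_add)

lemma glin_neg:
  assumes "glin n s d r e f"
  shows "glin n s d r e (\<lambda>v. - f v)"
  using assms
  by (auto simp: glin_def free_module_uminus hvec_uminus scal_uminus)

lemma glin_minus:
  assumes "glin n s d r e f" "glin n s d r e g"
  shows "glin n s d r e (\<lambda>v. f v - g v)"
  using glin_plus[OF assms(1) glin_neg[OF assms(2)]] by simp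

lemma glin_entry_pcarrier:
  assumes "glin n s d r e f" "j < s"
  shows "f (unitv j) i \<in> pcarrier n"
  by (rule free_module_pcarrier[OF glin_FM[OF assms(1) free_module_unitv[OF assms(2)]]])

lemma glin_entry_homogeneous:
  assumes "glin n s d r e f" "j < s"
  shows "homogeneous (f (unitv j) i) (d j - e i)"
  using glin_hvec[OF assms(1) free_module_unitv[OF assms(2)] hvec_unitv] by (simp add: hvec_def)

lemma glin_mat_apply:
  assumes "\<And>i j. i < r \<Longrightarrow> j < s \<Longrightarrow> A i j \<in> pcarrier n"
    and "\<And>i j. i < r \<Longrightarrow> j < s \<Longrightarrow> homogeneous (A i j) (d j - e i)"
  shows "glin n s d r e (mat_apply r s A)"
proof -
  have "homogeneous (\<Sum>j<s. A i j * v j) (q - e i)" if "hvec d q v" "i < r" for q v i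
  proof (rule homogeneous_sum)
    fix j assume "j \<in> {..<s}"
    then show "homogeneous (A i j * v j) (q - e i)"
      using homogeneous_mult[OF assms(2)[of i j], of "v j" "q - d j"] that
      by (simp add: hvec_def)
  qed
  then show ?thesis
    using assms(1)
    by (auto simp: glin_def mat_apply_def free_module_def hvec_def scal_def plus_fun_def
        distrib_left sum.distrib sum_distrib_left mult.left_commute
        intro!: pcarrier_sum pcarrier_mult)
qed

lemma mat_apply_unitv:
  "j < s \<Longrightarrow> mat_apply r s A (unitv j) i = (if i < r then A i j else 0)"
proof -
  assume "j < s"
  have "(\<Sum>k<s. A i k * unitv j k) = (\<Sum>k<s. if k = j then A i k else 0)"
    unfolding unitv_def by (rule sum.cong) auto
  with \<open>j < s\<close> show ?thesis by (simp add: mat_apply_def)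
qed

text \<open>The degrees match after replacing each chosen preimage of a basis vector by its
  homogeneous component of the right degree.\<close>

lemma glin_lift:
  assumes f: "glin n s d r e f" and g: "glin n s' d' r e g"
    and im: "\<And>v. v \<in> free_module n s \<Longrightarrow> f v \<in> g ` free_module n s'"
  shows "\<exists>h. glin n s d s' d' h \<and> (\<forall>v\<in>free_module n s. g (h v) = f v)"
proof -
  have "\<forall>j. \<exists>w. j < s \<longrightarrow> w \<in> free_module n s' \<and> g w = f (unitv j)"
    using im[OF free_module_unitv] by (metis imageE)
  then obtain w where w: "\<And>j. j < s \<Longrightarrow> w j \<in> free_module n s'"
    and gw: "\<And>j. j < s \<Longrightarrow> g (w j) = f (unitv j)" by metis
  define w' where "w' j i = hom_comp (d j - d' i) (w j i)" for j i
  define h where "h = mat_apply s' s (\<lambda>i j. w' j i)"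
  have w'F: "w' j \<in> free_module n s'" if "j < s" for j
    using w[OF that] by (auto simp: w'_def free_module_def hom_comp_pcarrier)
  have h: "glin n s d s' d' h"
    unfolding h_def
    by (rule glin_mat_apply)
       (auto simp: w'_def hom_comp_homogeneous intro!: hom_comp_pcarrier free_module_pcarrier[OF w])
  have hu: "h (unitv j) = w' j" if "j < s" for j
    using w'F[OF that] by (auto simp: h_def mat_apply_unitv[OF that] free_module_def)
  have gw': "g (w' j) = f (unitv j)" if j: "j < s" for j
  proof
    fix i
    \<comment> \<open>The entries of \<open>g\<close> are homogeneous, so \<open>g\<close> commutes
      with passing to components; \<open>f (unitv j)\<close> is already homogeneous and stays
      unchanged.\<close>
    have "g (w' j) i = (\<Sum>k<s'. w' j k * g (unitv k) i)"
      by (rule glin_expand[OF g w'F[OF j]])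
    also have "\<dots> = (\<Sum>k<s'. hom_comp (d j - e i) (w j k * g (unitv k) i))"
    proof (rule sum.cong[OF refl])
      fix k assume "k \<in> {..<s'}"
      then have "homogeneous (g (unitv k) i) (d' k - e i)"
        by (intro glin_entry_homogeneous[OF g]) simp
      from hom_comp_mult[OF this, of "d j - e i" "w j k"]
      show "w' j k * g (unitv k) i = hom_comp (d j - e i) (w j k * g (unitv k) i)"
        by (simp add: w'_def mult.commute)
    qed
    also have "\<dots> = hom_comp (d j - e i) (g (w j) i)"
      by (simp add: glin_expand[OF g w[OF j]] hom_comp_sum)
    also have "\<dots> = f (unitv j) i"
      unfolding gw[OF j] by (rule hom_comp_id[OF glin_entry_homogeneous[OF f j]])
    finally show "g (w' j) i = f (unitv j) i" .
  qed
  have "g (h v) = f v" if "v \<in> free_module n s" for v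
    by (rule glin_ext[OF glin_comp[OF h g] f that]) (simp add: hu gw')
  with h show ?thesis by blast
qed

section \<open>Reduction modulo the irrelevant ideal\<close>

text \<open>The matrix of \<open>f\<close> tensored with K = S/(x_1,...,x_n).\<close>

definition reduce :: "nat \<Rightarrow> nat \<Rightarrow> ((nat \<Rightarrow> ('k::field) mpoly) \<Rightarrow> nat \<Rightarrow> 'k mpoly) \<Rightarrow>
    (nat \<Rightarrow> 'k) \<Rightarrow> nat \<Rightarrow> 'k" where
  "reduce r s f = mat_apply r s (\<lambda>i j. const_coeff (f (unitv j) i))"

text \<open>Scalars have degree 0, so a vector over the field has degree \<open>q\<close> exactly
  when it is supported on basis elements of degree \<open>q\<close>.\<close>

definition gstrand :: "nat \<Rightarrow> (nat \<Rightarrow> int) \<Rightarrow> int \<Rightarrow> (nat \<Rightarrow> 'k::zero) set" where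
  "gstrand s d q = {v. \<forall>i. v i \<noteq> 0 \<longrightarrow> i < s \<and> d i = q}"

text \<open>Because \<open>const_coeff\<close> is a ring homomorphism, identities between maps over
  \<open>S\<close> descend to F tensor K: lift a vector, apply the identity, take constant
  coefficients.\<close>

lemma reduce_const_coeff:
  assumes f: "glin n s d r e f" and v: "v \<in> free_module n s"
  shows "reduce r s f (\<lambda>i. const_coeff (v i)) = (\<lambda>i. const_coeff (f v i))"
proof
  fix i
  show "reduce r s f (\<lambda>i. const_coeff (v i)) i = const_coeff (f v i)"
  proof (cases "i < r")
    case True
    then show ?thesis
      unfolding reduce_def mat_apply_def glin_expand[OF f v]
      by (simp add: const_coeff_sum const_coeff_mult mult.commute)
  next
    case False
    then have "f v i = 0"
      using glin_FM[OF f v] by (simp add: free_module_def)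
    with False show ?thesis by (simp add: reduce_def mat_apply_def)
  qed
qed

text \<open>Constant polynomials lift a vector over the field without leaving its degree.\<close>

lemma gstrand_lift:
  fixes v :: "nat \<Rightarrow> 'k::field"
  assumes "v \<in> gstrand s d q"
  obtains w where "w \<in> free_module n s" "hvec d q w" "v = (\<lambda>i. const_coeff (w i))"
proof
  let ?w = "\<lambda>i. Poly_Mapping.single 0 (v i)"
  have "v i = 0" if "i \<ge> s" for i
    using assms that by (auto simp: gstrand_def)
  then show "?w \<in> free_module n s"
    by (simp add: free_module_def)
  show "hvec d q ?w" "v = (\<lambda>i. const_coeff (?w i))"
    using assms by (auto simp: gstrand_def hvec_def homogeneous_def)
qed

text \<open>A homogeneous entry with nonzero constant term has degree 0, which pins down the degree
  of its basis element.\<close>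

lemma gstrand_const_coeff:
  assumes "w \<in> free_module n s" "hvec d q w"
  shows "(\<lambda>i. const_coeff (w i)) \<in> gstrand s d q"
proof -
  have "d i = q" if "const_coeff (w i) \<noteq> 0" for i
  proof -
    have "0 \<in> Poly_Mapping.keys (w i)"
      using that by (simp add: const_coeff_def in_keys_iff)
    then have "int (monomial_degree 0) = q - d i"
      using assms(2) unfolding hvec_def homogeneous_def by blast
    then show ?thesis by simp
  qed
  moreover have "i < s" if "const_coeff (w i) \<noteq> 0" for i
    using that assms(1) by (cases "i < s") (auto simp: free_module_def)
  ultimately show ?thesis by (auto simp: gstrand_def)
qed

lemma reduce_gstrand:
  assumes f: "glin n s d r e f" and v: "v \<in> gstrand s d q"
  shows "reduce r s f v \<in> gstrand r e q"
proof -
  obtain w where w: "w \<in> free_module n s" "hvec d q w" "v = (\<lambda>i. const_coeff (w i))"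
    using gstrand_lift[OF v] by blast
  show ?thesis
    unfolding w(3) reduce_const_coeff[OF f w(1)]
    by (rule gstrand_const_coeff[OF glin_FM[OF f w(1)] glin_hvec[OF f w(1,2)]])
qed

lemma mat_apply_add: "mat_apply r s A (u + v) = mat_apply r s A u + mat_apply r s A v"
  by (auto simp: mat_apply_def algebra_simps sum.distrib)

lemma mat_apply_scale: "mat_apply r s A (\<lambda>i. c * v i) = (\<lambda>i. c * mat_apply r s A v i)"
  by (auto simp: mat_apply_def sum_distrib_left algebra_simps)

section \<open>Resolutions with the ideal's ambient module in position 0\<close>

text \<open>Position \<open>Suc p\<close> holds $F_p$, position 0 holds \<open>S\<close> itself, and \<open>D 0\<close> is the
  augmentation, so that the augmentation needs no separate treatment.\<close>

definition gres :: "nat \<Rightarrow> ('k::field) mpoly set \<Rightarrow> (nat \<Rightarrow> nat) \<Rightarrow> (nat \<Rightarrow> nat \<Rightarrow> int) \<Rightarrow>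
    (nat \<Rightarrow> (nat \<Rightarrow> 'k mpoly) \<Rightarrow> nat \<Rightarrow> 'k mpoly) \<Rightarrow> bool" where
  "gres n J R T D \<longleftrightarrow>
     R 0 = 1 \<and> T 0 = (\<lambda>_. 0) \<and>
     (\<forall>p. glin n (R (Suc p)) (T (Suc p)) (R p) (T p) (D p)) \<and>
     (\<forall>p. {v \<in> free_module n (R (Suc p)). D p v = 0} = D (Suc p) ` free_module n (R (Suc (Suc p)))) \<and>
     D 0 ` free_module n (R 1) = {v \<in> free_module n 1. v 0 \<in> J}"

lemma gres_glin: "gres n J R T D \<Longrightarrow> glin n (R (Suc p)) (T (Suc p)) (R p) (T p) (D p)"
  by (simp add: gres_def)

lemma gres_0: "gres n J R T D \<Longrightarrow> R 0 = 1" "gres n J R T D \<Longrightarrow> T 0 = (\<lambda>_. 0)"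
  by (simp_all add: gres_def)

lemma gres_exact:
  "gres n J R T D \<Longrightarrow>
   {v \<in> free_module n (R (Suc p)). D p v = 0} = D (Suc p) ` free_module n (R (Suc (Suc p)))"
  by (simp add: gres_def)

lemma gres_DD:
  "gres n J R T D \<Longrightarrow> v \<in> free_module n (R (Suc (Suc p))) \<Longrightarrow> D p (D (Suc p) v) = 0"
  using gres_exact[of n J R T D p] by blast

lemma gres_kernel:
  "gres n J R T D \<Longrightarrow> v \<in> free_module n (R (Suc p)) \<Longrightarrow> D p v = 0 \<Longrightarrow>
   v \<in> D (Suc p) ` free_module n (R (Suc (Suc p)))"
  using gres_exact[of n J R T D p] by blast

lemma gres_image:
  "gres n J R T D \<Longrightarrow> D 0 ` free_module n (R 1) = {v \<in> free_module n 1. v 0 \<in> J}"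
  by (simp add: gres_def)

text \<open>The comparison theorem for resolutions. In position 0 the inclusion of \<open>J\<close>
  in \<open>J'\<close> is induced by the identity of \<open>S\<close>; the other components are
  lifted one position at a time along the exact target.\<close>

lemma gres_chain_map:
  assumes F: "gres n J R T D" and G: "gres n J' R' T' D'" and J: "J \<subseteq> J'"
  obtains a where "\<And>p. glin n (R p) (T p) (R' p) (T' p) (a p)" "a 0 = (\<lambda>v. v)"
    "\<And>p v. v \<in> free_module n (R (Suc p)) \<Longrightarrow> D' p (a (Suc p) v) = a p (D p v)"
proof -
  let ?F = "\<lambda>p. free_module n (R p)"
  \<comment> \<open>Dependent choice hands over only the current map \<open>g\<close>, so
    \<open>P\<close> must carry that \<open>g\<close> after \<open>D p\<close> lands in the image of
    \<open>D' p\<close>, which is what the next lifting requires.\<close>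
  define P where "P p g \<longleftrightarrow> glin n (R p) (T p) (R' p) (T' p) g \<and> (p = 0 \<longrightarrow> g = (\<lambda>v. v)) \<and>
    (\<forall>v\<in>?F (Suc p). g (D p v) \<in> D' p ` free_module n (R' (Suc p)))" for p g
  define Q where "Q p g h \<longleftrightarrow> (\<forall>v\<in>?F (Suc p). D' p (h v) = g (D p v))" for p g h
  have "\<exists>a. \<forall>p. P p (a p) \<and> Q p (a p) (a (Suc p))"
  proof (rule dependent_nat_choice)
    have "P 0 (\<lambda>v. v)"
      using gres_image[OF F] gres_image[OF G] J gres_0[OF F] gres_0[OF G]
      by (auto simp: P_def glin_id)
    then show "\<exists>g. P 0 g" by (rule exI[of "P 0"])
  next
    fix g p assume P: "P p g"
    then have g: "glin n (R p) (T p) (R' p) (T' p) g"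
      by (simp add: P_def)
    from P obtain h where h: "glin n (R (Suc p)) (T (Suc p)) (R' (Suc p)) (T' (Suc p)) h"
      and Dh: "\<forall>v\<in>?F (Suc p). D' p (h v) = g (D p v)"
      using glin_lift[OF glin_comp[OF gres_glin[OF F] g] gres_glin[OF G]]
      unfolding P_def by blast
    have "h (D (Suc p) v) \<in> D' (Suc p) ` free_module n (R' (Suc (Suc p)))"
      if v: "v \<in> ?F (Suc (Suc p))" for v
    proof (rule gres_kernel[OF G])
      have Dv: "D (Suc p) v \<in> ?F (Suc p)"
        using glin_FM[OF gres_glin[OF F] v] .
      then show "h (D (Suc p) v) \<in> free_module n (R' (Suc p))"
        by (rule glin_FM[OF h])
      show "D' p (h (D (Suc p) v)) = 0"
        using Dh Dv by (simp add: gres_DD[OF F v] glin_0[OF g])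
    qed
    then have "P (Suc p) h \<and> Q p g h"
      using h Dh by (simp add: P_def Q_def)
    then show "\<exists>h. P (Suc p) h \<and> Q p g h" by (rule exI[of "\<lambda>h. P (Suc p) h \<and> Q p g h"])
  qed
  then show thesis
    unfolding P_def Q_def by (metis that)
qed

text \<open>A lift of the identity is homotopic to the identity: the difference, less the previous
  homotopy term, is a cycle and lifts again. As \<open>a 0\<close> is the identity one can start
  from \<open>h 0 = 0\<close>, which keeps the homotopy away from the ambient
  \<open>S\<close>.\<close>

lemma gres_homotopy:
  assumes F: "gres n J R T D"
    and a: "\<And>p. glin n (R p) (T p) (R p) (T p) (a p)"
    and a0: "\<And>v. v \<in> free_module n (R 0) \<Longrightarrow> a 0 v = v"
    and chain: "\<And>p v. v \<in> free_module n (R (Suc p)) \<Longrightarrow> D p (a (Suc p) v) = a p (D p v)"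
  obtains h where "\<And>p. glin n (R p) (T p) (R (Suc p)) (T (Suc p)) (h p)" "h 0 = (\<lambda>v. 0)"
    "\<And>p v. v \<in> free_module n (R (Suc p)) \<Longrightarrow>
       a (Suc p) v = v + D (Suc p) (h (Suc p) v) + h p (D p v)"
proof -
  let ?F = "\<lambda>p. free_module n (R p)"
  define P where "P p g \<longleftrightarrow> glin n (R p) (T p) (R (Suc p)) (T (Suc p)) g \<and> (p = 0 \<longrightarrow> g = (\<lambda>v. 0)) \<and>
    (\<forall>v\<in>?F (Suc p). a (Suc p) v - v - g (D p v) \<in> D (Suc p) ` ?F (Suc (Suc p)))" for p g
  define Q where "Q p g h \<longleftrightarrow> (\<forall>v\<in>?F (Suc p). D (Suc p) (h v) = a (Suc p) v - v - g (D p v))" for p g h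
  have "\<exists>h. \<forall>p. P p (h p) \<and> Q p (h p) (h (Suc p))"
  proof (rule dependent_nat_choice)
    have "a 1 v - v \<in> D 1 ` ?F (Suc 1)" if v: "v \<in> ?F 1" for v
    proof -
      have av: "a 1 v \<in> ?F 1"
        by (rule glin_FM[OF a v])
      have "D 0 (a 1 v - v) = 0"
        using chain[of v 0] v av a0[OF glin_FM[OF gres_glin[OF F]], of v]
        by (simp add: glin_diff[OF gres_glin[OF F]])
      then show ?thesis
        using gres_kernel[OF F, of "a 1 v - v" 0] v av by (simp add: free_module_diff)
    qed
    then have "P 0 (\<lambda>v. 0)"
      by (simp add: P_def glin_zero_map)
    then show "\<exists>g. P 0 g" by (rule exI[of "P 0"])
  next
    fix g p assume P: "P p g"
    then have g: "glin n (R p) (T p) (R (Suc p)) (T (Suc p)) g"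
      by (simp add: P_def)
    let ?f = "\<lambda>v. a (Suc p) v - v - g (D p v)"
    have f: "glin n (R (Suc p)) (T (Suc p)) (R (Suc p)) (T (Suc p)) ?f"
      by (intro glin_minus a glin_id glin_comp[OF gres_glin[OF F] g])
    from P obtain h where h: "glin n (R (Suc p)) (T (Suc p)) (R (Suc (Suc p))) (T (Suc (Suc p))) h"
      and Dh: "\<forall>v\<in>?F (Suc p). D (Suc p) (h v) = ?f v"
      using glin_lift[OF f gres_glin[OF F]] unfolding P_def by blast
    have "a (Suc (Suc p)) v - v - h (D (Suc p) v) \<in> D (Suc (Suc p)) ` ?F (Suc (Suc (Suc p)))"
      if v: "v \<in> ?F (Suc (Suc p))" for v
    proof (rule gres_kernel[OF F])
      have Dv: "D (Suc p) v \<in> ?F (Suc p)"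
        by (rule glin_FM[OF gres_glin[OF F] v])
      have hv: "h (D (Suc p) v) \<in> ?F (Suc (Suc p))"
        by (rule glin_FM[OF h Dv])
      have av: "a (Suc (Suc p)) v \<in> ?F (Suc (Suc p))"
        by (rule glin_FM[OF a v])
      show "a (Suc (Suc p)) v - v - h (D (Suc p) v) \<in> ?F (Suc (Suc p))"
        by (intro free_module_diff v hv av)
      show "D (Suc p) (a (Suc (Suc p)) v - v - h (D (Suc p) v)) = 0"
        using Dh Dv
        by (simp add: glin_diff[OF gres_glin[OF F]] free_module_diff v hv av chain
            gres_DD[OF F v] glin_0[OF g])
    qed
    then have "P (Suc p) h \<and> Q p g h"
      using h Dh by (simp add: P_def Q_def)
    then show "\<exists>h. P (Suc p) h \<and> Q p g h" by (rule exI[of "\<lambda>h. P (Suc p) h \<and> Q p g h"])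
  qed
  then obtain h where h: "\<And>p. P p (h p) \<and> Q p (h p) (h (Suc p))" by blast
  show thesis
  proof (rule that)
    show "glin n (R p) (T p) (R (Suc p)) (T (Suc p)) (h p)" for p
      using h[of p] by (simp add: P_def)
    show "h 0 = (\<lambda>v. 0)"
      using h[of 0] by (simp add: P_def)
    show "a (Suc p) v = v + D (Suc p) (h (Suc p) v) + h p (D p v)"
      if "v \<in> ?F (Suc p)" for p v
      using h[of p] that by (simp add: Q_def)
  qed
qed

section \<open>Independence of the resolution\<close>

text \<open>The hypotheses make \<open>f\<close> induce an injection of Z/B into Z'/B'. A basis of
  \<open>B\<close> is extended to one of \<open>Z\<close>; the images of the added vectors, together
  with a basis of \<open>B'\<close>, stay independent in \<open>Z'\<close>. Finite spanning sets are
  given explicitly because the intended ambient space, all functions on the naturals, is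
  infinite-dimensional.\<close>

lemma (in vector_space) dim_quotient_mono:
  assumes f: "Vector_Spaces.linear scale scale f"
    and Z: "subspace Z" and B: "subspace B" and B': "subspace B'"
    and BZ: "B \<subseteq> Z" and BZ': "B' \<subseteq> Z'"
    and fZ: "f ` Z \<subseteq> Z'" and inj: "\<And>z. z \<in> Z \<Longrightarrow> f z \<in> B' \<Longrightarrow> z \<in> B"
    and fin: "finite U" "Z \<subseteq> span U" and fin': "finite U'" "Z' \<subseteq> span U'"
  shows "dim Z - dim B \<le> dim Z' - dim B'"
proof -
  interpret f: Vector_Spaces.linear scale scale f by (rule f)
  obtain b where b: "b \<subseteq> B" "independent b" "B \<subseteq> span b" "card b = dim B"
    by (rule basis_exists)
  obtain z where z: "b \<subseteq> z" "z \<subseteq> Z" "independent z" "Z \<subseteq> span z"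
    using maximal_independent_subset_extend[of b Z] b BZ by blast
  obtain b' where b': "b' \<subseteq> B'" "independent b'" "B' \<subseteq> span b'" "card b' = dim B'"
    by (rule basis_exists)
  have finz: "finite z"
    using independent_span_bound[OF fin(1) z(3)] z(2) fin(2) by blast
  have finb': "finite b'"
    using independent_span_bound[OF fin'(1) b'(2)] b'(1) BZ' fin'(2) by blast
  have cardz: "card z = dim Z"
    by (rule basis_card_eq_dim[OF z(2,4,3)])
  have span_b': "span b' = B'"
    using b' B' by (metis span_minimal subset_antisym)
  have "independent (f ` C \<union> b') \<and> card (f ` C \<union> b') = card C + card b'"
    if "C \<subseteq> z - b" for C
  proof -
    have "finite C" using that finz by (meson finite_Diff finite_subset)
    then show ?thesis using that
    proof (induction C)
      case empty
      then show ?case using b' by simp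
    next
      case (insert c C)
      have cz: "c \<in> Z" and CZ: "C \<subseteq> Z" using insert.prems z(2) by auto
      \<comment> \<open>A dependence gives f (c - y) in \<open>B'\<close> with y in the span of
        \<open>C\<close>; injectivity puts c - y into \<open>B\<close>, which makes \<open>c\<close>
        dependent on the rest of the basis \<open>z\<close>.\<close>
      have nsp: "f c \<notin> span (f ` C \<union> b')"
      proof
        assume "f c \<in> span (f ` C \<union> b')"
        then obtain y w where y: "y \<in> span C" and w: "w \<in> B'" and "f c = f y + w"
          unfolding span_Un f.span_image span_b' by blast
        then have "f (c - y) \<in> B'" by (simp add: f.diff)
        moreover have "y \<in> Z"
          using y CZ Z by (meson span_minimal subsetD)
        then have "c - y \<in> Z"
          using subspace_diff[OF Z cz] by simp
        ultimately have "c - y \<in> span b"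
          using inj b(3) by blast
        then have "c \<in> span (b \<union> C)"
          using span_add[of "c - y" "b \<union> C" y] y span_mono[of b "b \<union> C"] span_mono[of C "b \<union> C"]
          by auto
        also have "\<dots> \<subseteq> span (z - {c})"
          using insert.prems insert.hyps z(1) by (intro span_mono) auto
        finally show False
          using z(3) insert.prems unfolding dependent_def by blast
      qed
      then have "f c \<notin> f ` C \<union> b'"
        by (meson span_base)
      moreover have "independent (f ` C \<union> b')" "card (f ` C \<union> b') = card C + card b'"
        using insert.IH insert.prems by simp_all
      moreover have "finite (f ` C \<union> b')" using insert.hyps finb' by simp
      ultimately show ?case
        using insert.hyps independent_insertI[OF nsp] by simp
    qed
  qed
  from this[of "z - b"]
  have ind: "independent (f ` (z - b) \<union> b')"
    and card: "card (f ` (z - b) \<union> b') = card (z - b) + card b'" by auto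
  have sub: "f ` (z - b) \<union> b' \<subseteq> Z'"
    using z(2) fZ b'(1) BZ' by blast
  obtain c where c: "f ` (z - b) \<union> b' \<subseteq> c" "c \<subseteq> Z'" "independent c" "Z' \<subseteq> span c"
    using maximal_independent_subset_extend[OF sub ind] by blast
  have "finite c"
    using independent_span_bound[OF fin'(1) c(3)] c(2) fin'(2) by blast
  then have "card (z - b) + card b' \<le> dim Z'"
    using card_mono[OF _ c(1)] card basis_card_eq_dim[OF c(2,4,3)] by simp
  moreover have "card (z - b) = dim Z - dim B"
    using card_Diff_subset[of b z] z(1) finz cardz b(4) finite_subset by metis
  ultimately show ?thesis using b'(4) by simp
qed

text \<open>A constant for the scalar multiplication keeps the simplification rules of the
  interpretation from matching arbitrary abstractions.\<close>

definition kscale :: "'k::field \<Rightarrow> (nat \<Rightarrow> 'k) \<Rightarrow> nat \<Rightarrow> 'k" where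
  "kscale c v = (\<lambda>i. c * v i)"

interpretation fun_space: vector_space kscale
  by unfold_locales (auto simp: kscale_def algebra_simps)

lemma vec_dim_eq: "vec_dim V = fun_space.dim V"
  unfolding vec_dim_def kscale_def[abs_def] ..

section \<open>Strands of F tensor K: subspaces and dimensions\<close>

lemma linear_mat_apply:
  "Vector_Spaces.linear kscale kscale (mat_apply r s A)"
  by unfold_locales (auto simp: kscale_def mat_apply_add mat_apply_scale algebra_simps)

lemma linear_reduce:
  "Vector_Spaces.linear kscale kscale (reduce r s f)"
  unfolding reduce_def by (rule linear_mat_apply)

lemma subspace_gstrand: "fun_space.subspace (gstrand s d q :: (nat \<Rightarrow> 'k::field) set)"
proof -
  have "gstrand s d q = {v :: nat \<Rightarrow> 'k. \<forall>i. \<not> (i < s \<and> d i = q) \<longrightarrow> v i = 0}"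
    by (auto simp: gstrand_def)
  then show ?thesis
    by (auto simp: fun_space.subspace_def kscale_def)
qed

lemma gstrand_span:
  "(gstrand s d q :: (nat \<Rightarrow> 'k::field) set) \<subseteq> fun_space.span (unitv ` {i. i < s \<and> d i = q})"
proof
  fix v :: "nat \<Rightarrow> 'k" assume v: "v \<in> gstrand s d q"
  have "v = (\<Sum>j\<in>{i. i < s \<and> d i = q}. kscale (v j) (unitv j))"
  proof
    fix i
    have "(\<Sum>j\<in>{i. i < s \<and> d i = q}. kscale (v j) (unitv j)) i
        = (\<Sum>j\<in>{i. i < s \<and> d i = q}. if i = j then v j else 0)"
      unfolding sum_fun_at unitv_def kscale_def by (rule sum.cong) auto
    also have "\<dots> = v i"
      using v by (auto simp: gstrand_def)
    finally show "v i = (\<Sum>j\<in>{i. i < s \<and> d i = q}. kscale (v j) (unitv j)) i" ..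
  qed
  also have "\<dots> \<in> fun_space.span (unitv ` {i. i < s \<and> d i = q})"
    by (intro fun_space.span_sum fun_space.span_scale fun_space.span_base) simp
  finally show "v \<in> fun_space.span (unitv ` {i. i < s \<and> d i = q})" .
qed

lemma span_vanish:
  assumes "v \<in> fun_space.span W" "\<And>w. w \<in> W \<Longrightarrow> w i = 0"
  shows "v i = (0 :: 'k::field)"
  using assms(1)
  by (induction rule: fun_space.span_induct_alt) (auto simp: assms(2) kscale_def)

lemma dim_gstrand:
  "fun_space.dim (gstrand s d q :: (nat \<Rightarrow> 'k::field) set) = card {i. i < s \<and> d i = q}"
proof -
  let ?I = "{i. i < s \<and> d i = q}"
  let ?U = "unitv ` ?I :: (nat \<Rightarrow> 'k) set"
  have inj: "inj_on (unitv :: nat \<Rightarrow> nat \<Rightarrow> 'k) ?I"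
  proof (rule inj_onI)
    fix i j assume "(unitv i :: nat \<Rightarrow> 'k) = unitv j"
    then have "(unitv i i :: 'k) = unitv j i" by (rule fun_cong)
    then show "i = j" by (auto simp: unitv_def split: if_splits)
  qed
  have "fun_space.independent ?U"
    unfolding fun_space.dependent_def
  proof
    assume "\<exists>a\<in>?U. a \<in> fun_space.span (?U - {a})"
    then obtain i where "(unitv i :: nat \<Rightarrow> 'k) \<in> fun_space.span (?U - {unitv i})" by blast
    then have "(unitv i i :: 'k) = 0"
      by (rule span_vanish) (auto simp: unitv_def)
    then show False by (simp add: unitv_def)
  qed
  moreover have "?U \<subseteq> gstrand s d q"
    by (auto simp: gstrand_def unitv_def split: if_splits)
  ultimately have "card ?U = fun_space.dim (gstrand s d q :: (nat \<Rightarrow> 'k) set)"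
    by (intro fun_space.basis_card_eq_dim gstrand_span)
  then show ?thesis using card_image[OF inj] by simp
qed

text \<open>Homological degree \<open>p\<close> sits in position \<open>Suc p\<close>. For
  \<open>p = 0\<close> the map \<open>D 0\<close> is the augmentation into \<open>S\<close>, which
  does not belong to F tensor K, so the whole strand consists of cycles.\<close>

definition tcycles where
  "tcycles R T D p q = {v \<in> gstrand (R (Suc p)) (T (Suc p)) q.
     p = 0 \<or> reduce (R p) (R (Suc p)) (D p) v = 0}"

definition tbounds where
  "tbounds R T D p q =
     reduce (R (Suc p)) (R (Suc (Suc p))) (D (Suc p)) ` gstrand (R (Suc (Suc p))) (T (Suc (Suc p))) q"

lemma subspace_tcycles: "fun_space.subspace (tcycles R T D p q)"
proof -
  interpret f: Vector_Spaces.linear kscale kscale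
      "reduce (R p) (R (Suc p)) (D p)"
    by (rule linear_reduce)
  have "tcycles R T D p q = gstrand (R (Suc p)) (T (Suc p)) q \<inter>
      {v. p = 0 \<or> reduce (R p) (R (Suc p)) (D p) v = 0}"
    by (auto simp: tcycles_def)
  moreover have "fun_space.subspace {v. p = 0 \<or> reduce (R p) (R (Suc p)) (D p) v = 0}"
    using f.subspace_kernel by (cases "p = 0") simp_all
  ultimately show ?thesis
    by (simp add: fun_space.subspace_inter subspace_gstrand)
qed

lemma subspace_tbounds: "fun_space.subspace (tbounds R T D p q)"
proof -
  interpret f: Vector_Spaces.linear kscale kscale
      "reduce (R (Suc p)) (R (Suc (Suc p))) (D (Suc p))"
    by (rule linear_reduce)
  show ?thesis
    unfolding tbounds_def by (rule f.subspace_image[OF subspace_gstrand])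
qed

lemma tbounds_subset_tcycles:
  assumes F: "gres n J R T D"
  shows "tbounds R T D p q \<subseteq> tcycles R T D p q"
proof
  fix z assume "z \<in> tbounds R T D p q"
  then obtain y where y: "y \<in> gstrand (R (Suc (Suc p))) (T (Suc (Suc p))) q"
    and z: "z = reduce (R (Suc p)) (R (Suc (Suc p))) (D (Suc p)) y"
    by (auto simp: tbounds_def)
  obtain w where w: "w \<in> free_module n (R (Suc (Suc p)))" "y = (\<lambda>i. const_coeff (w i))"
    using gstrand_lift[OF y] by blast
  have "reduce (R p) (R (Suc p)) (D p) z = 0"
    unfolding z w(2) reduce_const_coeff[OF gres_glin[OF F] w(1)]
      reduce_const_coeff[OF gres_glin[OF F] glin_FM[OF gres_glin[OF F] w(1)]] gres_DD[OF F w(1)]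
    by (simp add: zero_fun_def)
  then show "z \<in> tcycles R T D p q"
    using reduce_gstrand[OF gres_glin[OF F] y] z by (simp add: tcycles_def)
qed

text \<open>The comparison map \<open>a\<close> is injective on Tor because \<open>b\<close> after
  \<open>a\<close> is homotopic to the identity. The reverse inequality follows by exchanging the
  two resolutions.\<close>

lemma tor_dim_le:
  fixes J :: "('k::field) mpoly set"
  assumes F: "gres n J R T D" and G: "gres n J R' T' D'"
  shows "fun_space.dim (tcycles R T D p q) - fun_space.dim (tbounds R T D p q)
    \<le> fun_space.dim (tcycles R' T' D' p q) - fun_space.dim (tbounds R' T' D' p q)"
proof -
  obtain a where a: "\<And>p. glin n (R p) (T p) (R' p) (T' p) (a p)" "a 0 = (\<lambda>v. v)"
    "\<And>p v. v \<in> free_module n (R (Suc p)) \<Longrightarrow> D' p (a (Suc p) v) = a p (D p v)"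
    using gres_chain_map[OF F G] by blast
  obtain b where b: "\<And>p. glin n (R' p) (T' p) (R p) (T p) (b p)" "b 0 = (\<lambda>v. v)"
    "\<And>p v. v \<in> free_module n (R' (Suc p)) \<Longrightarrow> D p (b (Suc p) v) = b p (D' p v)"
    using gres_chain_map[OF G F] by blast
  have ba: "D p (b (Suc p) (a (Suc p) v)) = b p (a p (D p v))"
    if "v \<in> free_module n (R (Suc p))" for p v
    using a(3)[OF that] b(3)[OF glin_FM[OF a(1) that]] by simp
  obtain h where h: "\<And>p. glin n (R p) (T p) (R (Suc p)) (T (Suc p)) (h p)" "h 0 = (\<lambda>v. 0)"
    "\<And>p v. v \<in> free_module n (R (Suc p)) \<Longrightarrow>
       b (Suc p) (a (Suc p) v) = v + D (Suc p) (h (Suc p) v) + h p (D p v)"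
    using gres_homotopy[OF F glin_comp[OF a(1) b(1)] _ ba] a(2) b(2) by auto
  note DF = gres_glin[OF F] and DG = gres_glin[OF G]
  let ?f = "reduce (R' (Suc p)) (R (Suc p)) (a (Suc p))"
  let ?cc = "\<lambda>w i. const_coeff (w i) :: 'k"
  have fz: "?f z \<in> tcycles R' T' D' p q" if z: "z \<in> tcycles R T D p q" for z
  proof -
    have zs: "z \<in> gstrand (R (Suc p)) (T (Suc p)) q"
      using z by (simp add: tcycles_def)
    obtain w where w: "w \<in> free_module n (R (Suc p))" "z = ?cc w"
      using gstrand_lift[OF zs] by blast
    have Dw: "D p w \<in> free_module n (R p)" by (rule glin_FM[OF DF w(1)])
    have aw: "a (Suc p) w \<in> free_module n (R' (Suc p))" by (rule glin_FM[OF a(1) w(1)])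
    have "reduce (R' p) (R' (Suc p)) (D' p) (?f z) = reduce (R' p) (R p) (a p) (reduce (R p) (R (Suc p)) (D p) z)"
      unfolding w(2) reduce_const_coeff[OF a(1) w(1)] reduce_const_coeff[OF DF w(1)]
        reduce_const_coeff[OF DG aw] reduce_const_coeff[OF a(1) Dw] a(3)[OF w(1)] ..
    moreover have "reduce (R' p) (R p) (a p) 0 = 0"
      by (auto simp: reduce_def mat_apply_def)
    ultimately show ?thesis
      using z reduce_gstrand[OF a(1) zs] by (auto simp: tcycles_def)
  qed
  have inj: "z \<in> tbounds R T D p q" if z: "z \<in> tcycles R T D p q" and fz: "?f z \<in> tbounds R' T' D' p q" for z
  proof -
    have zs: "z \<in> gstrand (R (Suc p)) (T (Suc p)) q"
      using z by (simp add: tcycles_def)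
    obtain w where w: "w \<in> free_module n (R (Suc p))" "hvec (T (Suc p)) q w" "z = ?cc w"
      using gstrand_lift[OF zs] by blast
    obtain y where y: "y \<in> gstrand (R' (Suc (Suc p))) (T' (Suc (Suc p))) q"
      and fy: "?f z = reduce (R' (Suc p)) (R' (Suc (Suc p))) (D' (Suc p)) y"
      using fz by (auto simp: tbounds_def)
    obtain x where x: "x \<in> free_module n (R' (Suc (Suc p)))" "hvec (T' (Suc (Suc p))) q x" "y = ?cc x"
      using gstrand_lift[OF y] by blast
    have aw: "a (Suc p) w \<in> free_module n (R' (Suc p))" by (rule glin_FM[OF a(1) w(1)])
    have Dx: "D' (Suc p) x \<in> free_module n (R' (Suc p))" by (rule glin_FM[OF DG x(1)])
    have bx: "b (Suc (Suc p)) x \<in> free_module n (R (Suc (Suc p)))" by (rule glin_FM[OF b(1) x(1)])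
    have hw: "h (Suc p) w \<in> free_module n (R (Suc (Suc p)))" by (rule glin_FM[OF h(1) w(1)])
    have Dw: "D p w \<in> free_module n (R p)" by (rule glin_FM[OF DF w(1)])
    have "?cc (a (Suc p) w) = ?cc (D' (Suc p) x)"
      using fy unfolding w(3) x(3) reduce_const_coeff[OF a(1) w(1)] reduce_const_coeff[OF DG x(1)] .
    then have "?cc (b (Suc p) (a (Suc p) w)) = ?cc (b (Suc p) (D' (Suc p) x))"
      using reduce_const_coeff[OF b(1) aw] reduce_const_coeff[OF b(1) Dx] by simp
    then have 1: "?cc (b (Suc p) (a (Suc p) w)) = ?cc (D (Suc p) (b (Suc (Suc p)) x))"
      using b(3)[OF x(1)] by simp
    \<comment> \<open>The last homotopy term vanishes after reduction: for \<open>p = 0\<close>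
      since \<open>h 0 = 0\<close>, otherwise since \<open>z\<close> is a cycle.\<close>
    have 2: "?cc (h p (D p w)) = (\<lambda>i. 0)"
    proof (cases "p = 0")
      case True
      then show ?thesis using h(2) by simp
    next
      case False
      then have "reduce (R p) (R (Suc p)) (D p) z = 0"
        using z by (simp add: tcycles_def)
      then have "?cc (D p w) = 0"
        unfolding w(3) reduce_const_coeff[OF DF w(1)] .
      then have "?cc (h p (D p w)) = reduce (R (Suc p)) (R p) (h p) 0"
        using reduce_const_coeff[OF h(1) Dw] by simp
      then show ?thesis
        by (auto simp: reduce_def mat_apply_def)
    qed
    have 3: "const_coeff (b (Suc p) (a (Suc p) w) i)
        = const_coeff (w i) + const_coeff (D (Suc p) (h (Suc p) w) i) + const_coeff (h p (D p w) i)" for i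
      using h(3)[OF w(1)] by (simp add: const_coeff_add)
    \<comment> \<open>The homotopy writes \<open>w\<close> as b (a w) - D (h w) - h (D w), and b (a
      w) agrees with D (b x) in constant coefficients; hence b x - h w reduces to a preimage of
      \<open>z\<close>.\<close>
    have "z = ?cc (D (Suc p) (b (Suc (Suc p)) x - h (Suc p) w))"
      using 3 fun_cong[OF 1] fun_cong[OF 2] unfolding w(3)
      by (auto simp: glin_diff[OF DF bx hw] const_coeff_diff)
    also have "\<dots> = reduce (R (Suc p)) (R (Suc (Suc p))) (D (Suc p)) (?cc (b (Suc (Suc p)) x - h (Suc p) w))"
      by (rule reduce_const_coeff[OF DF free_module_diff[OF bx hw], symmetric])
    also have "\<dots> \<in> tbounds R T D p q"
    proof -
      have "hvec (T (Suc (Suc p))) q (b (Suc (Suc p)) x - h (Suc p) w)"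
        using hvec_add[OF glin_hvec[OF b(1) x(1,2)] hvec_uminus[OF glin_hvec[OF h(1) w(1,2)]]]
        by simp
      then show ?thesis
        unfolding tbounds_def
        by (rule imageI[OF gstrand_const_coeff[OF free_module_diff[OF bx hw]]])
    qed
    finally show ?thesis .
  qed
  show ?thesis
  proof (rule fun_space.dim_quotient_mono[OF linear_reduce])
    show "?f ` tcycles R T D p q \<subseteq> tcycles R' T' D' p q" using fz by blast
    show "tcycles R T D p q \<subseteq> fun_space.span (unitv ` {i. i < R (Suc p) \<and> T (Suc p) i = q})"
      "tcycles R' T' D' p q \<subseteq> fun_space.span (unitv ` {i. i < R' (Suc p) \<and> T' (Suc p) i = q})"
      using gstrand_span unfolding tcycles_def by blast+
  qed (simp_all add: subspace_tcycles subspace_tbounds tbounds_subset_tcycles[OF F]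
      tbounds_subset_tcycles[OF G] inj)
qed

section \<open>Betti numbers from an explicit resolution\<close>

lemma gres_of_resolution:
  assumes F: "graded_free_resolution n J F"
  shows "gres n J (case_nat 1 (rk F)) (case_nat (\<lambda>_. 0) (shift F))
    (case_nat (\<lambda>v i. if i = 0 then aug_apply F v else 0) (bdry_apply F))"
proof -
  let ?a = "\<lambda>v (i::nat). if i = 0 then aug_apply F v else (0 :: 'a mpoly)"
  have a: "?a = mat_apply 1 (rk F 0) (\<lambda>i j. aug F j)"
    by (intro ext) (auto simp: mat_apply_def aug_apply_def mult.commute)
  have ga: "glin n (rk F 0) (shift F 0) 1 (\<lambda>_. 0) ?a"
    unfolding a using F by (intro glin_mat_apply) (auto simp: graded_free_resolution_def)
  have gb: "glin n (rk F (Suc p)) (shift F (Suc p)) (rk F p) (shift F p) (bdry_apply F p)" for p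
    unfolding bdry_apply_def using F
    by (intro glin_mat_apply) (auto simp: graded_free_resolution_def)
  have a0: "?a v = 0 \<longleftrightarrow> aug_apply F v = 0" for v
    by (auto simp: fun_eq_iff)
  have im: "?a ` free_module n (rk F 0) = {v \<in> free_module n 1. v 0 \<in> J}"
  proof (intro equalityI subsetI)
    fix x assume "x \<in> ?a ` free_module n (rk F 0)"
    then obtain v where v: "v \<in> free_module n (rk F 0)" "x = ?a v" by blast
    have "aug_apply F v \<in> J"
      using F v(1) unfolding graded_free_resolution_def by blast
    then have "x 0 \<in> J"
      by (simp add: v(2))
    moreover have "x \<in> free_module n 1"
      unfolding v(2) by (rule glin_FM[OF ga v(1)])
    ultimately show "x \<in> {v \<in> free_module n 1. v 0 \<in> J}" by blast
  next
    fix x assume x: "x \<in> {v \<in> free_module n 1. v 0 \<in> J}"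
    then have "x 0 \<in> aug_apply F ` free_module n (rk F 0)"
      using F by (simp add: graded_free_resolution_def)
    then obtain v where v: "v \<in> free_module n (rk F 0)" "x 0 = aug_apply F v" by blast
    have "x = ?a v"
      using x v(2) by (simp add: free_module_def fun_eq_iff)
    with v(1) show "x \<in> ?a ` free_module n (rk F 0)" by blast
  qed
  have ex: "{v \<in> free_module n (rk F p). (case p of 0 \<Rightarrow> ?a | Suc q \<Rightarrow> bdry_apply F q) v = 0}
      = bdry_apply F p ` free_module n (rk F (Suc p))" for p
    using F a0 by (cases p) (simp_all add: graded_free_resolution_def)
  show ?thesis
    unfolding gres_def using ga gb im ex by (auto split: nat.split)
qed

lemma resolution_of_gres:
  assumes G: "gres n J R T D" and J: "J \<subseteq> pcarrier n"
  shows "graded_free_resolution n J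
    \<lparr>rk = \<lambda>p. R (Suc p), shift = \<lambda>p. T (Suc p), bdry = \<lambda>p i j. D (Suc p) (unitv j) i,
     aug = \<lambda>i. D 0 (unitv i) 0\<rparr>" (is "graded_free_resolution n J ?F")
proof -
  note DG = gres_glin[OF G]
  have aug: "aug_apply ?F v = D 0 v 0" if "v \<in> free_module n (R (Suc 0))" for v
    using glin_expand[OF DG[of 0], of v 0] that by (simp add: aug_apply_def)
  have bd: "bdry_apply ?F p v = D (Suc p) v" if v: "v \<in> free_module n (R (Suc (Suc p)))" for p v
    using glin_expand[OF DG v] glin_FM[OF DG v]
    by (auto simp: bdry_apply_def mat_apply_def free_module_def fun_eq_iff mult.commute)
  have D0: "D 0 v = 0 \<longleftrightarrow> D 0 v 0 = 0" if v: "v \<in> free_module n (R (Suc 0))" for v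
  proof -
    have "D 0 v i = 0" if "i \<noteq> 0" for i
      using glin_FM[OF DG[of 0], of v] v gres_0[OF G] that by (simp add: free_module_def)
    then have "(\<forall>i. D 0 v i = 0) \<longleftrightarrow> D 0 v 0 = 0" by metis
    then show ?thesis by (simp add: fun_eq_iff)
  qed
  have "aug_apply ?F ` free_module n (R (Suc 0)) = (\<lambda>v. D 0 v 0) ` free_module n (R (Suc 0))"
    by (intro image_cong refl aug)
  also have "\<dots> = (\<lambda>x. x 0) ` {v \<in> free_module n 1. v 0 \<in> J}"
    unfolding gres_image[OF G, symmetric] image_image by (simp only: One_nat_def)
  also have "\<dots> = J"
  proof (intro equalityI subsetI)
    fix f assume f: "f \<in> J"
    then have "(\<lambda>i. if i = 0 then f else 0) \<in> {v \<in> free_module n 1. v 0 \<in> J}"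
      using J by (auto simp: free_module_def)
    then show "f \<in> (\<lambda>x. x 0) ` {v \<in> free_module n 1. v 0 \<in> J}"
      by (rule rev_image_eqI) simp
  qed auto
  finally have im: "aug_apply ?F ` free_module n (R (Suc 0)) = J" .
  have bim: "bdry_apply ?F p ` free_module n (R (Suc (Suc p))) = D (Suc p) ` free_module n (R (Suc (Suc p)))" for p
    by (intro image_cong refl bd)
  have ex0: "{v \<in> free_module n (R (Suc 0)). aug_apply ?F v = 0}
      = bdry_apply ?F 0 ` free_module n (R (Suc (Suc 0)))"
    unfolding bim gres_exact[OF G, symmetric]
    by (intro Collect_cong conj_cong refl) (simp only: aug D0)
  have ex: "{v \<in> free_module n (R (Suc (Suc p))). bdry_apply ?F p v = 0}
      = bdry_apply ?F (Suc p) ` free_module n (R (Suc (Suc (Suc p))))" for p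
    unfolding bim gres_exact[OF G, symmetric]
    by (intro Collect_cong conj_cong refl) (simp only: bd)
  have h0: "homogeneous (D 0 (unitv i) 0) (T (Suc 0) i)" if "i < R (Suc 0)" for i
    using glin_entry_homogeneous[OF DG[of 0] that, of 0] gres_0[OF G] by simp
  show ?thesis
  proof (unfold graded_free_resolution_def, intro conjI allI impI)
    fix i assume "i < rk ?F 0"
    then show "aug ?F i \<in> pcarrier n" "homogeneous (aug ?F i) (shift ?F 0 i)"
      using h0 by (simp_all add: glin_entry_pcarrier[OF DG])
  next
    fix p i j assume "i < rk ?F p" "j < rk ?F (Suc p)"
    then show "bdry ?F p i j \<in> pcarrier n"
      "homogeneous (bdry ?F p i j) (shift ?F (Suc p) j - shift ?F p i)"
      by (simp_all add: glin_entry_pcarrier[OF DG] glin_entry_homogeneous[OF DG])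
  next
    fix p
    show "{v \<in> free_module n (rk ?F (Suc p)). bdry_apply ?F p v = 0}
        = bdry_apply ?F (Suc p) ` free_module n (rk ?F (Suc (Suc p)))"
      unfolding free_complex.simps by (rule ex)
  next
    show "aug_apply ?F ` free_module n (rk ?F 0) = J"
      unfolding free_complex.simps by (rule im)
    show "{v \<in> free_module n (rk ?F 0). aug_apply ?F v = 0} = bdry_apply ?F 0 ` free_module n (rk ?F 1)"
      unfolding free_complex.simps One_nat_def by (rule ex0)
  qed
qed

text \<open>Only the numbers of basis elements per homological degree and internal degree are kept:
  under mapping cones they add, with an offset of one position for the intersection, and under
  multiplication by a monomial they are translated.\<close>

definition has_res :: "nat \<Rightarrow> ('k::field) mpoly set \<Rightarrow> (nat \<Rightarrow> int \<Rightarrow> nat) \<Rightarrow> bool" where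
  "has_res n J c \<longleftrightarrow> (\<exists>R T D. gres n J R T D \<and>
     (\<forall>p q. card {i. i < R (Suc p) \<and> T (Suc p) i = q} = c p q))"

text \<open>The given resolution guarantees that the \<open>SOME\<close>-choice yields a resolution;
  \<open>tor_dim_le\<close> in both directions then gives equality.\<close>

lemma betti_eq_tor_dim:
  fixes J :: "('k::field) mpoly set"
  assumes G: "gres n J R T D" and J: "J \<subseteq> pcarrier n"
  shows "betti n J p q = fun_space.dim (tcycles R T D p q) - fun_space.dim (tbounds R T D p q)"
proof -
  define F where "F = (SOME F. graded_free_resolution n J F)"
  have F: "graded_free_resolution n J F"
    unfolding F_def using resolution_of_gres[OF G J] by (rule someI)
  define R' where "R' = case_nat 1 (rk F)"
  define T' where "T' = case_nat (\<lambda>_. 0) (shift F)"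
  define D' where "D' = case_nat (\<lambda>v i. if i = 0 then aug_apply F v else 0) (bdry_apply F)"
  have F': "gres n J R' T' D'"
    using gres_of_resolution[OF F] by (simp add: R'_def T'_def D'_def)
  have red: "reduce (R' (Suc p)) (R' (Suc (Suc p))) (D' (Suc p)) = bdry_tensor F p" for p
  proof (intro ext)
    fix v i
    have "const_coeff (bdry_apply F p (unitv j) i) = const_coeff (bdry F p i j)"
      if "i < rk F p" "j < rk F (Suc p)" for j
      using that by (simp add: bdry_apply_def mat_apply_unitv)
    then show "reduce (R' (Suc p)) (R' (Suc (Suc p))) (D' (Suc p)) v i = bdry_tensor F p v i"
      by (auto simp: reduce_def bdry_tensor_def R'_def D'_def mat_apply_def intro!: sum.cong)
  qed
  have str: "strand F p q = gstrand (R' (Suc p)) (T' (Suc p)) q" for p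
    by (simp add: strand_def gstrand_def R'_def T'_def)
  have "tor_cycles F p q = tcycles R' T' D' p q"
    by (cases p) (auto simp: tcycles_def str red)
  moreover have "tor_boundaries F p q = tbounds R' T' D' p q"
    by (simp add: tor_boundaries_def tbounds_def str red)
  ultimately have "betti n J p q
      = fun_space.dim (tcycles R' T' D' p q) - fun_space.dim (tbounds R' T' D' p q)"
    by (simp add: betti_def F_def[symmetric] vec_dim_eq Let_def)
  then show ?thesis
    using tor_dim_le[OF F' G, of p q] tor_dim_le[OF G F', of p q] by simp
qed

section \<open>Betti numbers and projective dimension from ranks\<close>

lemma gstrand_eq_0: "card {i. i < s \<and> d i = q} = 0 \<Longrightarrow> v \<in> gstrand s d q \<Longrightarrow> v = 0"
  by (auto simp: gstrand_def fun_eq_iff)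

lemma betti_le_rank:
  fixes J :: "('k::field) mpoly set"
  assumes G: "gres n J R T D" and J: "J \<subseteq> pcarrier n"
  shows "betti n J p q \<le> card {i. i < R (Suc p) \<and> T (Suc p) i = q}" (is "_ \<le> card ?I")
proof -
  have "tcycles R T D p q \<subseteq> fun_space.span (unitv ` ?I :: (nat \<Rightarrow> 'k) set)"
    using gstrand_span unfolding tcycles_def by blast
  then have "fun_space.dim (tcycles R T D p q) \<le> card (unitv ` ?I :: (nat \<Rightarrow> 'k) set)"
    by (rule fun_space.dim_le_card) simp
  also have "\<dots> \<le> card ?I"
    by (rule card_image_le) simp
  finally show ?thesis
    unfolding betti_eq_tor_dim[OF G J] by simp
qed

lemma betti_le:
  assumes "has_res n J c" "J \<subseteq> pcarrier n"
  shows "betti n J p q \<le> c p q"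
proof -
  obtain R T D where G: "gres n J R T D"
    and c: "\<And>p q. card {i. i < R (Suc p) \<and> T (Suc p) i = q} = c p q"
    using assms(1) unfolding has_res_def by blast
  show ?thesis
    using betti_le_rank[OF G assms(2), of p q] by (simp only: c)
qed

text \<open>With nothing of degree \<open>q\<close> in the neighbouring positions, the reduced
  differentials into and out of position \<open>p\<close> vanish in degree \<open>q\<close>, so
  every basis element survives to Tor.\<close>

lemma betti_eq:
  fixes J :: "('k::field) mpoly set"
  assumes "has_res n J c" and J: "J \<subseteq> pcarrier n"
    and up: "c (Suc p) q = 0" and down: "p > 0 \<Longrightarrow> c (p - 1) q = 0"
  shows "betti n J p q = c p q"
proof -
  obtain R T D where G: "gres n J R T D"
    and c: "\<And>p q. card {i. i < R (Suc p) \<and> T (Suc p) i = q} = c p q"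
    using assms(1) unfolding has_res_def by blast
  have "reduce (R p) (R (Suc p)) (D p) v = 0"
    if "p > 0" "v \<in> gstrand (R (Suc p)) (T (Suc p)) q" for v
    using gstrand_eq_0[OF _ reduce_gstrand[OF gres_glin[OF G] that(2)]] c[of "p - 1" q] down that(1)
    by simp
  then have "tcycles R T D p q = gstrand (R (Suc p)) (T (Suc p)) q"
    by (auto simp: tcycles_def)
  moreover have "tbounds R T D p q \<subseteq> {0}"
  proof
    fix z assume "z \<in> tbounds R T D p q"
    then obtain y where "y \<in> gstrand (R (Suc (Suc p))) (T (Suc (Suc p))) q"
      and z: "z = reduce (R (Suc p)) (R (Suc (Suc p))) (D (Suc p)) y"
      by (auto simp: tbounds_def)
    then have "y = 0"
      using gstrand_eq_0[OF c[of "Suc p" q, unfolded up]] by blast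
    then show "z \<in> {0}"
      by (auto simp: z reduce_def mat_apply_def)
  qed
  then have "fun_space.dim (tbounds R T D p q) = 0"
    using fun_space.dim_le_card[of "tbounds R T D p q" "{}"] by simp
  ultimately show ?thesis
    by (simp add: betti_eq_tor_dim[OF G J] dim_gstrand c)
qed

text \<open>A resolution of length less than \<open>l\<close> has rank 0 at \<open>l\<close>; since
  the ranks of any resolution bound the Betti numbers, this contradicts \<open>betti n J l q\<close>
  being nonzero.\<close>

lemma proj_dim_eq:
  fixes J :: "('k::field) mpoly set"
  assumes c: "has_res n J c" and J: "J \<subseteq> pcarrier n"
    and zero: "\<And>p q. p > l \<Longrightarrow> c p q = 0" and nz: "betti n J l q \<noteq> 0"
  shows "proj_dim n J = l"
  unfolding proj_dim_def
proof (rule Least_equality)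
  obtain R T D where G: "gres n J R T D"
    and c: "\<And>p q. card {i. i < R (Suc p) \<and> T (Suc p) i = q} = c p q"
    using c unfolding has_res_def by blast
  have "R (Suc p) = 0" if "p > l" for p
  proof -
    \<comment> \<open>If the rank were positive, the first basis element would be counted in its own
      degree \<open>T (Suc p) 0\<close>.\<close>
    have "{i. i < R (Suc p) \<and> T (Suc p) i = T (Suc p) 0} = {}"
      using c[of p "T (Suc p) 0"] zero[OF that] by simp
    then show ?thesis
      by (metis (mono_tags, lifting) empty_Collect_eq gr0I)
  qed
  then have "\<forall>p>l. rk \<lparr>rk = \<lambda>p. R (Suc p), shift = \<lambda>p. T (Suc p), bdry = \<lambda>p i j. D (Suc p) (unitv j) i,
     aug = \<lambda>i. D 0 (unitv i) 0\<rparr> p = 0"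
    by simp
  then show "\<exists>F. graded_free_resolution n J F \<and> (\<forall>p>l. rk F p = 0)"
    using resolution_of_gres[OF G J] by blast
next
  fix l' assume "\<exists>F. graded_free_resolution n J F \<and> (\<forall>p>l'. rk F p = 0)"
  then obtain F where F: "graded_free_resolution n J F" and 0: "\<forall>p>l'. rk F p = 0" by blast
  show "l \<le> l'"
  proof (rule ccontr)
    assume "\<not> l \<le> l'"
    then have "rk F l = 0" using 0 by simp
    then show False
      using betti_le_rank[OF gres_of_resolution[OF F] J, of l q] nz by simp
  qed
qed

section \<open>Mapping cones\<close>

text \<open>A direct sum is a concatenation of coordinate vectors, the first \<open>a\<close>
  entries belonging to the left summand. Vectors vanish beyond their rank, so the injection of the
  left summand is the identity and has no constant of its own.\<close>

definition left_part :: "nat \<Rightarrow> (nat \<Rightarrow> 'r::zero) \<Rightarrow> nat \<Rightarrow> 'r" where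
  "left_part a w = (\<lambda>i. if i < a then w i else 0)"

definition right_part :: "nat \<Rightarrow> (nat \<Rightarrow> 'r) \<Rightarrow> nat \<Rightarrow> 'r" where
  "right_part a w = (\<lambda>i. w (i + a))"

definition right_inj :: "nat \<Rightarrow> (nat \<Rightarrow> 'r::zero) \<Rightarrow> nat \<Rightarrow> 'r" where
  "right_inj a v = (\<lambda>i. if i < a then 0 else v (i - a))"

definition shift_sum :: "nat \<Rightarrow> (nat \<Rightarrow> int) \<Rightarrow> (nat \<Rightarrow> int) \<Rightarrow> nat \<Rightarrow> int" where
  "shift_sum a d e = (\<lambda>i. if i < a then d i else e (i - a))"

lemma free_module_iff: "v \<in> free_module n s \<longleftrightarrow> (\<forall>i. v i \<in> pcarrier n) \<and> (\<forall>i\<ge>s. v i = 0)"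
  using free_module_pcarrier[of v n s] by (auto simp: free_module_def)

lemma left_inj_free_module: "u \<in> free_module n a \<Longrightarrow> u \<in> free_module n (a + b)"
  by (simp add: free_module_iff)

lemma right_inj_free_module: "v \<in> free_module n b \<Longrightarrow> right_inj a v \<in> free_module n (a + b)"
  by (simp add: free_module_iff right_inj_def)

lemma glin_left_inj:
  "glin n a d (a + b) (shift_sum a d e) (\<lambda>v :: nat \<Rightarrow> ('k::field) mpoly. v)"
proof -
  have "hvec (shift_sum a d e) q v" if "v \<in> free_module n a" "hvec d q v"
    for q and v :: "nat \<Rightarrow> 'k mpoly"
    unfolding hvec_def
  proof
    fix i show "homogeneous (v i) (q - shift_sum a d e i)"
      using that by (cases "i < a") (auto simp: hvec_def shift_sum_def free_module_iff)
  qed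
  then show ?thesis
    by (simp add: glin_def left_inj_free_module)
qed

lemma glin_right_inj: "glin n b e (a + b) (shift_sum a d e) (right_inj a)"
  unfolding glin_def
  by (intro conjI ballI allI impI right_inj_free_module)
     (auto simp: hvec_def shift_sum_def right_inj_def scal_def fun_eq_iff)

lemma glin_left_part:
  "glin n (a + b) (shift_sum a d e) a d (left_part a :: (nat \<Rightarrow> ('k::field) mpoly) \<Rightarrow> _)"
proof -
  have "homogeneous (if i < a then v i else 0) (q - d i)"
    if "hvec (shift_sum a d e) q v" for q i and v :: "nat \<Rightarrow> 'k mpoly"
    using that[unfolded hvec_def, rule_format, of i] by (cases "i < a") (simp_all add: shift_sum_def)
  then show ?thesis
    by (auto simp: glin_def free_module_def hvec_def left_part_def scal_def fun_eq_iff)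
qed

lemma glin_right_part:
  "glin n (a + b) (shift_sum a d e) b e (right_part a :: (nat \<Rightarrow> ('k::field) mpoly) \<Rightarrow> _)"
proof -
  have "homogeneous (v (i + a)) (q - e i)"
    if "hvec (shift_sum a d e) q v" for q i and v :: "nat \<Rightarrow> 'k mpoly"
    using that[unfolded hvec_def, rule_format, of "i + a"] by (simp add: shift_sum_def)
  then show ?thesis
    by (auto simp: glin_def free_module_def hvec_def right_part_def scal_def fun_eq_iff)
qed

lemma left_part_sum:
  fixes u :: "nat \<Rightarrow> ('k::field) mpoly"
  shows "u \<in> free_module n a \<Longrightarrow> left_part a (u + right_inj a v) = u"
  by (auto simp: left_part_def right_inj_def free_module_def fun_eq_iff)

lemma right_part_sum:
  fixes u :: "nat \<Rightarrow> ('k::field) mpoly"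
  shows "u \<in> free_module n a \<Longrightarrow> right_part a (u + right_inj a v) = v"
  by (auto simp: right_part_def right_inj_def free_module_def fun_eq_iff)

lemma sum_parts: "left_part a w + right_inj a (right_part a w) = (w :: nat \<Rightarrow> 'r::comm_monoid_add)"
  by (auto simp: left_part_def right_part_def right_inj_def fun_eq_iff)

lemma card_shift_sum:
  "card {i. i < a + b \<and> shift_sum a d e i = q} = card {i. i < a \<and> d i = q} + card {i. i < b \<and> e i = q}"
proof -
  have "{i. i < a + b \<and> shift_sum a d e i = q}
      = {i. i < a \<and> d i = q} \<union> (\<lambda>i. i + a) ` {i. i < b \<and> e i = q}"
  proof (intro equalityI subsetI)
    fix i assume i: "i \<in> {i. i < a + b \<and> shift_sum a d e i = q}"
    show "i \<in> {i. i < a \<and> d i = q} \<union> (\<lambda>i. i + a) ` {i. i < b \<and> e i = q}"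
    proof (cases "i < a")
      case False
      then have "i - a < b \<and> e (i - a) = q" "i = i - a + a"
        using i by (auto simp: shift_sum_def)
      then show ?thesis by blast
    qed (use i in \<open>simp add: shift_sum_def\<close>)
  qed (auto simp: shift_sum_def)
  moreover have "{i. i < a \<and> d i = q} \<inter> (\<lambda>i. i + a) ` {i. i < b \<and> e i = q} = {}" by auto
  moreover have "card ((\<lambda>i. i + a) ` {i. i < b \<and> e i = q}) = card {i. i < b \<and> e i = q}"
    by (rule card_image) simp
  ultimately show ?thesis
    by (simp add: card_Un_disjoint)
qed

section \<open>Threefold direct sums, the shape of the terms of the cone\<close>

definition pack where
  "pack a b u v z = u + right_inj a (v + right_inj b z)"

definition part1 where "part1 a w = left_part a w"
definition part2 where "part2 a b w = left_part b (right_part a w)"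
definition part3 where "part3 a b w = right_part b (right_part a w)"

lemma pack_parts [simp]:
  fixes u v z :: "nat \<Rightarrow> ('k::field) mpoly"
  assumes "u \<in> free_module n a" "v \<in> free_module n b"
  shows "part1 a (pack a b u v z) = u" "part2 a b (pack a b u v z) = v" "part3 a b (pack a b u v z) = z"
  using assms
  by (simp_all add: pack_def part1_def part2_def part3_def left_part_sum right_part_sum)

lemma parts_pack [simp]:
  "pack a b (part1 a w) (part2 a b w) (part3 a b w) = (w :: nat \<Rightarrow> ('k::field) mpoly)"
  by (simp add: pack_def part1_def part2_def part3_def sum_parts)

lemma pack_0 [simp]: "pack a b 0 0 0 = (0 :: nat \<Rightarrow> ('k::field) mpoly)"
  by (auto simp: pack_def right_inj_def fun_eq_iff)

abbreviation shift_sum3 where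
  "shift_sum3 a b d e f \<equiv> shift_sum a d (shift_sum b e f)"

lemma glin_part1: "glin n (a + (b + c)) (shift_sum3 a b d e f) a d (part1 a)"
  unfolding part1_def[abs_def] by (rule glin_left_part)

lemma glin_part2: "glin n (a + (b + c)) (shift_sum3 a b d e f) b e (part2 a b)"
  unfolding part2_def[abs_def] by (rule glin_comp[OF glin_right_part glin_left_part])

lemma glin_part3: "glin n (a + (b + c)) (shift_sum3 a b d e f) c f (part3 a b)"
  unfolding part3_def[abs_def] by (rule glin_comp[OF glin_right_part glin_right_part])

lemma glin_pack:
  assumes "glin n s t a d g" "glin n s t b e h" "glin n s t c f k"
  shows "glin n s t (a + (b + c)) (shift_sum3 a b d e f) (\<lambda>v. pack a b (g v) (h v) (k v))"
  unfolding pack_def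
  by (intro glin_plus glin_comp[OF _ glin_left_inj] glin_comp[OF _ glin_right_inj] assms)

lemma pack_free_module:
  assumes "u \<in> free_module n a" "v \<in> free_module n b" "z \<in> free_module n c"
  shows "pack a b u v z \<in> free_module n (a + (b + c))"
  unfolding pack_def
  by (intro free_module_add right_inj_free_module left_inj_free_module assms)

text \<open>The resolution of $A + B$ is the mapping cone of the comparison map
  $F_{A \cap B} \to F_A \oplus F_B$; \<open>C 0\<close>, which would be the ambient ring, is left out.\<close>

lemma has_res_sum:
  fixes A B :: "('k::field) mpoly set"
  assumes A: "has_res n A cA" and B: "has_res n B cB" and C: "has_res n (A \<inter> B) cC"
    and AS: "A \<subseteq> pcarrier n" and BS: "B \<subseteq> pcarrier n"
    and J: "J = {f + g |f g. f \<in> A \<and> g \<in> B}"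
  shows "has_res n J (\<lambda>p q. cA p q + cB p q + (if p = 0 then 0 else cC (p - 1) q))"
proof -
  obtain RA TA DA where GA: "gres n A RA TA DA"
    and cA: "\<And>p q. card {i. i < RA (Suc p) \<and> TA (Suc p) i = q} = cA p q"
    using A unfolding has_res_def by blast
  obtain RB TB DB where GB: "gres n B RB TB DB"
    and cB: "\<And>p q. card {i. i < RB (Suc p) \<and> TB (Suc p) i = q} = cB p q"
    using B unfolding has_res_def by blast
  obtain RC TC DC where GC: "gres n (A \<inter> B) RC TC DC"
    and cC: "\<And>p q. card {i. i < RC (Suc p) \<and> TC (Suc p) i = q} = cC p q"
    using C unfolding has_res_def by blast
  note LA = gres_glin[OF GA] and LB = gres_glin[OF GB] and LC = gres_glin[OF GC]
  obtain \<alpha> where \<alpha>: "\<And>p. glin n (RC p) (TC p) (RA p) (TA p) (\<alpha> p)" "\<alpha> 0 = (\<lambda>v. v)"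
    "\<And>p v. v \<in> free_module n (RC (Suc p)) \<Longrightarrow> DA p (\<alpha> (Suc p) v) = \<alpha> p (DC p v)"
    using gres_chain_map[OF GC GA Int_lower1] by blast
  obtain \<beta> where \<beta>: "\<And>p. glin n (RC p) (TC p) (RB p) (TB p) (\<beta> p)" "\<beta> 0 = (\<lambda>v. v)"
    "\<And>p v. v \<in> free_module n (RC (Suc p)) \<Longrightarrow> DB p (\<beta> (Suc p) v) = \<beta> p (DC p v)"
    using gres_chain_map[OF GC GB Int_lower2] by blast
  \<comment> \<open>\<open>RK\<close> and \<open>DK\<close> describe the resolution of the
    intersection without its ambient \<open>S\<close>: rank 0 in position 0, the zero map out of
    position 1, and above that the negated differential, whose sign makes the square of
    \<open>D\<close> vanish.\<close>
  define RK where "RK p = (if p = 0 then 0 else RC p)" for p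
  define DK where "DK p v = (if p = 0 then 0 else - DC p v)" for p v
  have LK: "glin n (RC (Suc p)) (TC (Suc p)) (RK p) (TC p) (DK p)" for p
  proof (cases "p = 0")
    case True
    then show ?thesis using glin_zero_map by (simp add: DK_def[abs_def])
  next
    case False
    then show ?thesis using glin_neg[OF LC[of p]] by (simp add: DK_def[abs_def] RK_def)
  qed
  have LI: "glin n (RK p) (TC p) (RC p) (TC p) (\<lambda>v. v)" for p
    by (auto simp: RK_def glin_def free_module_zero_rank)
  define R where "R p = (case p of 0 \<Rightarrow> 1 | Suc p \<Rightarrow> RA (Suc p) + (RB (Suc p) + RK p))" for p
  define T where "T p = (case p of 0 \<Rightarrow> \<lambda>_. 0 | Suc p \<Rightarrow>
      shift_sum3 (RA (Suc p)) (RB (Suc p)) (TA (Suc p)) (TB (Suc p)) (TC p))" for p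
  let ?u = "\<lambda>p. part1 (RA (Suc p))"
  let ?v = "\<lambda>p. part2 (RA (Suc p)) (RB (Suc p))"
  let ?z = "\<lambda>p. part3 (RA (Suc p)) (RB (Suc p))"
  \<comment> \<open>\<open>\<alpha>\<close> enters with plus and \<open>\<beta>\<close> with minus,
    so that the two copies of an element of the intersection cancel in A + B.\<close>
  define D where "D p w = (case p of 0 \<Rightarrow> DA 0 (?u 0 w) + DB 0 (?v 0 w)
      | Suc p' \<Rightarrow> pack (RA p) (RB p) (DA p (?u p w) + \<alpha> p (?z p w)) (DB p (?v p w) - \<beta> p (?z p w))
          (DK p' (?z p w)))" for p w
  let ?E = "\<lambda>p. free_module n (R p)"
  have u: "glin n (R (Suc p)) (T (Suc p)) (RA (Suc p)) (TA (Suc p)) (?u p)" for p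
    by (simp add: R_def T_def glin_part1)
  have v: "glin n (R (Suc p)) (T (Suc p)) (RB (Suc p)) (TB (Suc p)) (?v p)" for p
    by (simp add: R_def T_def glin_part2)
  have zK: "glin n (R (Suc p)) (T (Suc p)) (RK p) (TC p) (?z p)" for p
    by (simp add: R_def T_def glin_part3)
  have z: "glin n (R (Suc p)) (T (Suc p)) (RC p) (TC p) (?z p)" for p
    by (rule glin_comp[OF zK LI])
  have LD: "glin n (R (Suc p)) (T (Suc p)) (R p) (T p) (D p)" for p
  proof (cases p)
    case 0
    have "glin n (RA (Suc 0)) (TA (Suc 0)) (R 0) (T 0) (DA 0)"
      "glin n (RB (Suc 0)) (TB (Suc 0)) (R 0) (T 0) (DB 0)"
      using LA[of 0] LB[of 0] by (simp_all add: R_def T_def gres_0[OF GA] gres_0[OF GB])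
    then have "glin n (R (Suc 0)) (T (Suc 0)) (R 0) (T 0) (\<lambda>w. DA 0 (?u 0 w) + DB 0 (?v 0 w))"
      by (intro glin_plus glin_comp[OF u] glin_comp[OF v])
    then show ?thesis by (simp add: 0 D_def[abs_def])
  next
    case (Suc p')
    have "glin n (R (Suc p)) (T (Suc p)) (RA p + (RB p + RK p')) (shift_sum3 (RA p) (RB p) (TA p) (TB p) (TC p'))
      (\<lambda>w. pack (RA p) (RB p) (DA p (?u p w) + \<alpha> p (?z p w)) (DB p (?v p w) - \<beta> p (?z p w)) (DK p' (?z p w)))"
      by (intro glin_pack glin_plus glin_minus glin_comp[OF u LA] glin_comp[OF v LB]
          glin_comp[OF z \<alpha>(1)] glin_comp[OF z \<beta>(1)] glin_comp[OF z LK[of p', folded Suc]])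
    then show ?thesis by (simp add: Suc D_def[abs_def] R_def T_def)
  qed
  have parts: "?u p w \<in> free_module n (RA (Suc p))" "?v p w \<in> free_module n (RB (Suc p))"
      "?z p w \<in> free_module n (RC p)" if "w \<in> ?E (Suc p)" for p w
    using glin_FM[OF u that] glin_FM[OF v that] glin_FM[OF z that] by blast+
  have D0: "D 0 w = DA 0 (?u 0 w) + DB 0 (?v 0 w)" for w
    by (simp add: D_def)
  have DSuc: "D (Suc p) w = pack (RA (Suc p)) (RB (Suc p))
      (DA (Suc p) (?u (Suc p) w) + \<alpha> (Suc p) (?z (Suc p) w))
      (DB (Suc p) (?v (Suc p) w) - \<beta> (Suc p) (?z (Suc p) w)) (DK p (?z (Suc p) w))" for p w
    by (simp add: D_def)
  have compl: "D p (D (Suc p) w) = 0" if w: "w \<in> ?E (Suc (Suc p))" for p w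
  proof -
    define x where "x = ?u (Suc p) w"
    define y where "y = ?v (Suc p) w"
    define t where "t = ?z (Suc p) w"
    note xyt = parts[OF w, folded x_def y_def t_def]
    have 1: "DA (Suc p) x \<in> free_module n (RA (Suc p))" "\<alpha> (Suc p) t \<in> free_module n (RA (Suc p))"
      "DB (Suc p) y \<in> free_module n (RB (Suc p))" "\<beta> (Suc p) t \<in> free_module n (RB (Suc p))"
      using glin_FM[OF LA xyt(1)] glin_FM[OF LB xyt(2)] glin_FM[OF \<alpha>(1) xyt(3)] glin_FM[OF \<beta>(1) xyt(3)]
      by blast+
    note pp = pack_parts[OF free_module_add[OF 1(1,2)] free_module_diff[OF 1(3,4)]]
    have a: "DA p (DA (Suc p) x + \<alpha> (Suc p) t) = \<alpha> p (DC p t)"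
      using glin_add[OF LA 1(1,2)] gres_DD[OF GA xyt(1)] \<alpha>(3)[OF xyt(3)] by simp
    have b: "DB p (DB (Suc p) y - \<beta> (Suc p) t) = - \<beta> p (DC p t)"
      using glin_diff[OF LB 1(3,4)] gres_DD[OF GB xyt(2)] \<beta>(3)[OF xyt(3)] by simp
    show ?thesis
    \<comment> \<open>In position 0 the two terms cancel each other because
      \<open>\<alpha> 0\<close> and \<open>\<beta> 0\<close> are both the identity; above, each
      cancels against the image of - DC p t.\<close>
    proof (cases p)
      case 0
      show ?thesis
        unfolding DSuc x_def[symmetric] y_def[symmetric] t_def[symmetric]
        using a b pp by (simp add: 0 D0 \<alpha>(2) \<beta>(2))
    next
      case (Suc p')
      have Dt: "DC p t \<in> free_module n (RC p)"
        by (rule glin_FM[OF LC xyt(3)])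
      have k: "DK p t = - DC p t"
        by (simp add: DK_def Suc)
      have "DK p' (- DC p t) = 0"
        using gres_DD[OF GC, of t p'] xyt(3) glin_uminus[OF LC, of "DC p t" p'] Dt
        by (simp add: DK_def Suc)
      moreover have "\<alpha> p (- DC p t) = - \<alpha> p (DC p t)" "\<beta> p (- DC p t) = - \<beta> p (DC p t)"
        by (rule glin_uminus[OF \<alpha>(1) Dt], rule glin_uminus[OF \<beta>(1) Dt])
      ultimately show ?thesis
        unfolding DSuc x_def[symmetric] y_def[symmetric] t_def[symmetric] k
        using a b pp by (simp add: Suc DSuc)
    qed
  qed
  have kernel: "w \<in> D (Suc p) ` ?E (Suc (Suc p))" if w: "w \<in> ?E (Suc p)" and Dw: "D p w = 0" for p w
  proof -
    define x where "x = ?u p w"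
    define y where "y = ?v p w"
    define t where "t = ?z p w"
    note xyt = parts[OF w, folded x_def y_def t_def]
    \<comment> \<open>\<open>s\<close> is the intersection component of the preimage. Once it is
      found, the corrected \<open>x\<close> and \<open>y\<close> are cycles and lift separately over
      A and over B.\<close>
    have "\<exists>s\<in>free_module n (RC (Suc p)).
      DA p (x - \<alpha> (Suc p) s) = 0 \<and> DB p (y + \<beta> (Suc p) s) = 0 \<and> t = DK p s"
    proof (cases p)
      case 0
      have t0: "t = 0"
        using glin_FM[OF zK w] by (simp add: t_def 0 RK_def free_module_zero_rank)
      \<comment> \<open>This element lies in A by its left and in B by its right expression, hence
        in the image of \<open>DC 0\<close>.\<close>
      have DA: "DA 0 x = - DB 0 y"
        using Dw by (simp add: 0 D0 x_def y_def eq_neg_iff_add_eq_0)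
      have "DA 0 x \<in> {v \<in> free_module n 1. v 0 \<in> A}"
        unfolding gres_image[OF GA, symmetric] using xyt(1) by (simp add: 0)
      moreover have "- DB 0 y = DB 0 (- y)"
        by (rule glin_uminus[OF LB, symmetric]) (use xyt(2) in \<open>simp add: 0\<close>)
      then have "DA 0 x \<in> {v \<in> free_module n 1. v 0 \<in> B}"
        unfolding gres_image[OF GB, symmetric] DA using xyt(2) by (simp add: 0 free_module_uminus)
      ultimately have "DA 0 x \<in> DC 0 ` free_module n (RC 1)"
        unfolding gres_image[OF GC] by simp
      then obtain s where s: "s \<in> free_module n (RC (Suc 0))" "DC 0 s = DA 0 x"
        by auto
      have "DA 0 (x - \<alpha> (Suc 0) s) = 0"
        using glin_diff[OF LA _ glin_FM[OF \<alpha>(1) s(1)], of x] xyt(1) \<alpha>(3)[OF s(1)] s(2)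
        by (simp add: 0 \<alpha>(2))
      moreover have "DB 0 (y + \<beta> (Suc 0) s) = 0"
        using glin_add[OF LB _ glin_FM[OF \<beta>(1) s(1)], of y] xyt(2) \<beta>(3)[OF s(1)] s(2) DA
        by (simp add: 0 \<beta>(2))
      ultimately show ?thesis
        using s(1) t0 by (auto simp: 0 DK_def)
    next
      case (Suc p')
      have t: "t \<in> free_module n (RC (Suc p'))"
        using xyt(3) by (simp add: Suc)
      have 1: "DA p x \<in> free_module n (RA p)" "\<alpha> p t \<in> free_module n (RA p)"
        "DB p y \<in> free_module n (RB p)" "\<beta> p t \<in> free_module n (RB p)"
        using glin_FM[OF LA xyt(1)] glin_FM[OF LB xyt(2)] glin_FM[OF \<alpha>(1) xyt(3)] glin_FM[OF \<beta>(1) xyt(3)]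
        by blast+
      have "pack (RA p) (RB p) (DA p x + \<alpha> p t) (DB p y - \<beta> p t) (DK p' t) = 0"
        using Dw by (simp add: Suc DSuc x_def y_def t_def)
      then have "part1 (RA p) (pack (RA p) (RB p) (DA p x + \<alpha> p t) (DB p y - \<beta> p t) (DK p' t)) = 0"
        "part2 (RA p) (RB p) (pack (RA p) (RB p) (DA p x + \<alpha> p t) (DB p y - \<beta> p t) (DK p' t)) = 0"
        "part3 (RA p) (RB p) (pack (RA p) (RB p) (DA p x + \<alpha> p t) (DB p y - \<beta> p t) (DK p' t)) = 0"
        by (auto simp: part1_def part2_def part3_def left_part_def right_part_def fun_eq_iff)
      then have a: "DA p x + \<alpha> p t = 0" and b: "DB p y - \<beta> p t = 0" and k: "DK p' t = 0"
        unfolding pack_parts[OF free_module_add[OF 1(1,2)] free_module_diff[OF 1(3,4)]] .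
      have "DC p' t = 0"
      proof (cases "p' = 0")
        case True
        \<comment> \<open>\<open>DK 0\<close> is zero and says nothing about \<open>t\<close>;
          instead \<open>DA 0\<close> is applied to the first component, where
          \<open>\<alpha> 0\<close> being the identity leaves \<open>DC 0 t\<close>.\<close>
        have "DA 0 (DA (Suc 0) x + \<alpha> (Suc 0) t) = DC 0 t"
          using glin_add[OF LA[of 0], of "DA (Suc 0) x" "\<alpha> (Suc 0) t"] 1(1,2) xyt(1,3)
            gres_DD[OF GA, of x 0] \<alpha>(3)[of t 0]
          by (simp add: Suc True \<alpha>(2))
        then show ?thesis
          using a glin_0[OF LA[of 0]] by (simp add: Suc True)
      next
        case False
        then show ?thesis using k by (simp add: DK_def)
      qed
      then obtain s where s: "s \<in> free_module n (RC (Suc p))" "t = DC p s"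
        using gres_kernel[OF GC t] by (auto simp: Suc)
      \<comment> \<open>The preimage is negated because \<open>DK p\<close> is minus
        \<open>DC p\<close> in this case.\<close>
      have ms: "- s \<in> free_module n (RC (Suc p))"
        by (rule free_module_uminus[OF s(1)])
      have Dms: "DC p (- s) = - t"
        using glin_uminus[OF LC s(1)] s(2) by simp
      have "DA p (x - \<alpha> (Suc p) (- s)) = 0"
        using glin_diff[OF LA xyt(1) glin_FM[OF \<alpha>(1) ms]] \<alpha>(3)[OF ms] a
        by (simp add: Dms glin_uminus[OF \<alpha>(1) xyt(3)])
      moreover have "DB p (y + \<beta> (Suc p) (- s)) = 0"
        using glin_add[OF LB xyt(2) glin_FM[OF \<beta>(1) ms]] \<beta>(3)[OF ms] b
        by (simp add: Dms glin_uminus[OF \<beta>(1) xyt(3)])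
      moreover have "t = DK p (- s)"
        by (simp add: DK_def Suc Dms[unfolded Suc])
      ultimately show ?thesis using ms by blast
    qed
    then obtain s where s: "s \<in> free_module n (RC (Suc p))" and a: "DA p (x - \<alpha> (Suc p) s) = 0"
      and b: "DB p (y + \<beta> (Suc p) s) = 0" and t: "t = DK p s" by blast
    note as = glin_FM[OF \<alpha>(1) s] and bs = glin_FM[OF \<beta>(1) s]
    obtain x' where x': "x' \<in> free_module n (RA (Suc (Suc p)))" "x - \<alpha> (Suc p) s = DA (Suc p) x'"
      using gres_kernel[OF GA free_module_diff[OF xyt(1) as] a] by blast
    obtain y' where y': "y' \<in> free_module n (RB (Suc (Suc p)))" "y + \<beta> (Suc p) s = DB (Suc p) y'"
      using gres_kernel[OF GB free_module_add[OF xyt(2) bs] b] by blast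
    let ?w = "pack (RA (Suc (Suc p))) (RB (Suc (Suc p))) x' y' s"
    have "?w \<in> ?E (Suc (Suc p))"
      using pack_free_module[OF x'(1) y'(1) s] by (simp add: R_def RK_def)
    moreover have "w = D (Suc p) ?w"
    proof -
      have "x = DA (Suc p) x' + \<alpha> (Suc p) s" "y = DB (Suc p) y' - \<beta> (Suc p) s"
        using x'(2) y'(2) by (metis diff_add_cancel, metis add_diff_cancel_right')
      then have "D (Suc p) ?w = pack (RA (Suc p)) (RB (Suc p)) x y t"
        unfolding DSuc pack_parts[OF x'(1) y'(1)] t by simp
      then show ?thesis
        by (simp add: x_def y_def t_def)
    qed
    ultimately show ?thesis by blast
  qed
  have image: "D 0 ` ?E 1 = {v \<in> free_module n 1. v 0 \<in> J}"
  proof (intro equalityI subsetI)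
    fix x assume "x \<in> D 0 ` ?E 1"
    then obtain w where w: "w \<in> ?E (Suc 0)" "x = D 0 w" by auto
    have "DA 0 (?u 0 w) \<in> {v \<in> free_module n 1. v 0 \<in> A}"
      unfolding gres_image[OF GA, symmetric] using parts(1)[OF w(1)] by simp
    moreover have "DB 0 (?v 0 w) \<in> {v \<in> free_module n 1. v 0 \<in> B}"
      unfolding gres_image[OF GB, symmetric] using parts(2)[OF w(1)] by simp
    ultimately show "x \<in> {v \<in> free_module n 1. v 0 \<in> J}"
      using free_module_add by (fastforce simp: w(2) D0 J)
  next
    fix x assume "x \<in> {v \<in> free_module n 1. v 0 \<in> J}"
    then obtain f g where x: "x \<in> free_module n 1" and fg: "f \<in> A" "g \<in> B" "x 0 = f + g"
      unfolding J by blast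
    let ?c = "\<lambda>f (i::nat). if i = 0 then f else (0 :: 'k mpoly)"
    have "?c f \<in> {v \<in> free_module n 1. v 0 \<in> A}" "?c g \<in> {v \<in> free_module n 1. v 0 \<in> B}"
      using fg AS BS by (auto simp: free_module_def)
    then have im: "?c f \<in> DA 0 ` free_module n (RA (Suc 0))" "?c g \<in> DB 0 ` free_module n (RB (Suc 0))"
      unfolding gres_image[OF GA, unfolded One_nat_def] gres_image[OF GB, unfolded One_nat_def] One_nat_def .
    obtain a where a: "?c f = DA 0 a" "a \<in> free_module n (RA (Suc 0))"
      using im(1) by (rule imageE)
    obtain b where b: "?c g = DB 0 b" "b \<in> free_module n (RB (Suc 0))"
      using im(2) by (rule imageE)
    let ?w = "pack (RA (Suc 0)) (RB (Suc 0)) a b 0"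
    have "x = ?c f + ?c g"
      using x fg(3) by (auto simp: free_module_def fun_eq_iff)
    then have "x = D 0 ?w"
      unfolding D0 pack_parts[OF a(2) b(2)] a(1) b(1) .
    moreover have "?w \<in> ?E 1"
      using pack_free_module[OF a(2) b(2), of 0 0] by (simp add: R_def RK_def)
    ultimately show "x \<in> D 0 ` ?E 1" by blast
  qed
  have "gres n J R T D"
    unfolding gres_def
  proof (intro conjI allI LD image)
    fix p show "{v \<in> ?E (Suc p). D p v = 0} = D (Suc p) ` ?E (Suc (Suc p))"
      using compl kernel glin_FM[OF LD] by blast
  qed (simp_all add: R_def T_def)
  moreover have "card {i. i < R (Suc p) \<and> T (Suc p) i = q}
      = cA p q + cB p q + (if p = 0 then 0 else cC (p - 1) q)" for p q
  proof -
    have "card {i. i < R (Suc p) \<and> T (Suc p) i = q} = cA p q + (cB p q + card {i. i < RK p \<and> TC p i = q})"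
      by (simp add: R_def T_def card_shift_sum cA cB)
    also have "card {i. i < RK p \<and> TC p i = q} = (if p = 0 then 0 else cC (p - 1) q)"
      using cC[of "p - 1" q] by (cases p) (simp_all add: RK_def)
    finally show ?thesis by simp
  qed
  ultimately show ?thesis
    unfolding has_res_def by blast
qed

section \<open>Resolutions of S itself and of monomial multiples of an ideal\<close>

lemma has_res_pcarrier: "has_res n (pcarrier n :: ('k::field) mpoly set) (\<lambda>p q. if p = 0 \<and> q = 0 then 1 else 0)"
proof -
  let ?R = "\<lambda>p::nat. if p \<le> 1 then 1 else 0 :: nat"
  let ?D = "\<lambda>p (v :: nat \<Rightarrow> 'k mpoly). if p = (0::nat) then v else 0"
  have "gres n (pcarrier n :: 'k mpoly set) ?R (\<lambda>_ _. 0) ?D"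
    unfolding gres_def
  proof (intro conjI allI)
    fix p
    show "glin n (?R (Suc p)) (\<lambda>_. 0) (?R p) (\<lambda>_. 0) (?D p)"
      by (cases "p = 0") (simp_all add: glin_id glin_zero_map)
    show "{v \<in> free_module n (?R (Suc p)). ?D p v = 0} = ?D (Suc p) ` free_module n (?R (Suc (Suc p)))"
      by (cases "p = 0") (auto simp: free_module_zero_rank image_iff intro: bexI[of _ 0])
  qed (auto simp: free_module_pcarrier)
  moreover have "card {i. i < ?R (Suc p) \<and> (0::int) = q} = (if p = 0 \<and> q = 0 then 1 else 0)" for p q
    by auto
  ultimately show ?thesis
    unfolding has_res_def by blast
qed

text \<open>Multiplication by a monomial is injective, so the same modules and maps resolve the
  multiple; only the augmentation is multiplied, and the shifts above position 0 grow by the degree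
  of the monomial.\<close>

lemma has_res_monomial_mult:
  fixes J :: "('k::field) mpoly set"
  assumes J: "has_res n J c" and m: "Poly_Mapping.keys m \<subseteq> {1..n}" and JS: "J \<subseteq> pcarrier n"
  shows "has_res n ((*) (Poly_Mapping.single m 1) ` J) (\<lambda>p q. c p (q - int (monomial_degree m)))"
proof -
  obtain R T D where G: "gres n J R T D"
    and c: "\<And>p q. card {i. i < R (Suc p) \<and> T (Suc p) i = q} = c p q"
    using J unfolding has_res_def by blast
  define \<mu> where "\<mu> = (Poly_Mapping.single m 1 :: 'k mpoly)"
  define \<delta> where "\<delta> = int (monomial_degree m)"
  have \<mu>S: "\<mu> \<in> pcarrier n"
    using m by (simp add: \<mu>_def pcarrier_eq)
  have \<mu>h: "homogeneous \<mu> \<delta>"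
    by (simp add: \<mu>_def \<delta>_def homogeneous_eq)
  have "\<mu> \<noteq> 0"
    by (simp add: \<mu>_def flip: keys_eq_empty)
  then have \<mu>0: "scal \<mu> v = 0 \<longleftrightarrow> v = 0" for v
    by (simp add: scal_def fun_eq_iff)
  define T' where "T' p = (case p of 0 \<Rightarrow> (\<lambda>_. 0) | Suc q \<Rightarrow> (\<lambda>i. T p i + \<delta>))" for p
  define D' where "D' p v = (case p of 0 \<Rightarrow> scal \<mu> (D 0 v) | Suc q \<Rightarrow> D p v)" for p v
  have hs: "hvec (\<lambda>i. d i + \<delta>) q v \<longleftrightarrow> hvec d (q - \<delta>) v" for d q and v :: "nat \<Rightarrow> 'k mpoly"
    by (simp add: hvec_def algebra_simps)
  have hm: "hvec d q (scal \<mu> v)" if "hvec d (q - \<delta>) v" for d q v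
    using homogeneous_mult[OF \<mu>h] that by (fastforce simp: hvec_def scal_def algebra_simps)
  have L: "glin n (R (Suc p)) (T' (Suc p)) (R p) (T' p) (D' p)" for p
    using gres_glin[OF G, of p]
  proof (cases p)
    case 0
    show ?thesis
      using gres_glin[OF G, of 0] hm gres_0[OF G]
      by (auto simp: 0 glin_def T'_def D'_def hs scal_add free_module_scal[OF \<mu>S])
         (auto simp: scal_def algebra_simps)
  next
    case (Suc q)
    then show ?thesis
      using gres_glin[OF G, of p]
      by (auto simp: Suc glin_def T'_def D'_def[abs_def] hs)
  qed
  have "D' 0 ` free_module n (R 1) = scal \<mu> ` D 0 ` free_module n (R 1)"
    by (simp add: D'_def image_image)
  also have "\<dots> = scal \<mu> ` {v \<in> free_module n 1. v 0 \<in> J}"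
    unfolding gres_image[OF G] ..
  also have "\<dots> = {v \<in> free_module n 1. v 0 \<in> (*) \<mu> ` J}"
  proof (intro equalityI subsetI)
    fix x assume "x \<in> {v \<in> free_module n 1. v 0 \<in> (*) \<mu> ` J}"
    then obtain f where x: "x \<in> free_module n 1" and f: "f \<in> J" "x 0 = \<mu> * f" by blast
    let ?v = "\<lambda>i::nat. if i = 0 then f else 0"
    have "?v \<in> {v \<in> free_module n 1. v 0 \<in> J}"
      using f JS by (auto simp: free_module_def)
    moreover have "x = scal \<mu> ?v"
      using x f(2) by (auto simp: free_module_def scal_def fun_eq_iff)
    ultimately show "x \<in> scal \<mu> ` {v \<in> free_module n 1. v 0 \<in> J}" by blast
  next
    fix x assume "x \<in> scal \<mu> ` {v \<in> free_module n 1. v 0 \<in> J}"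
    then obtain v where v: "v \<in> free_module n 1" "v 0 \<in> J" "x = scal \<mu> v" by blast
    have "x 0 \<in> (*) \<mu> ` J"
      unfolding v(3) scal_def by (rule imageI[OF v(2)])
    then show "x \<in> {v \<in> free_module n 1. v 0 \<in> (*) \<mu> ` J}"
      using free_module_scal[OF \<mu>S v(1)] v(3) by blast
  qed
  finally have im: "D' 0 ` free_module n (R 1) = {v \<in> free_module n 1. v 0 \<in> (*) \<mu> ` J}" .
  have ex: "{v \<in> free_module n (R (Suc p)). D' p v = 0} = D' (Suc p) ` free_module n (R (Suc (Suc p)))" for p
    using gres_exact[OF G, of p] by (cases p) (simp_all add: D'_def \<mu>0)
  have "gres n ((*) \<mu> ` J) R T' D'"
    unfolding gres_def using L im ex gres_0[OF G] by (simp add: T'_def)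
  moreover have "card {i. i < R (Suc p) \<and> T' (Suc p) i = q} = c p (q - \<delta>)" for p q
    unfolding c[symmetric] T'_def by (rule arg_cong[of _ _ card]) auto
  ultimately show ?thesis
    unfolding has_res_def \<mu>_def \<delta>_def by blast
qed

section \<open>Squarefree monomial ideals\<close>

text \<open>For upward closed \<open>P\<close> this is a squarefree monomial ideal, given by the
  supports of its monomials instead of by generators, so that intersections and sums become
  conjunctions and disjunctions of predicates.\<close>

definition mon_ideal :: "nat \<Rightarrow> (nat set \<Rightarrow> bool) \<Rightarrow> ('k::field) mpoly set" where
  "mon_ideal n P = supp_in {m. Poly_Mapping.keys m \<subseteq> {1..n} \<and> P (Poly_Mapping.keys m)}"

definition covers :: "nat set set \<Rightarrow> nat set \<Rightarrow> bool" where
  "covers E W \<longleftrightarrow> (\<forall>e\<in>E. W \<inter> e \<noteq> {})"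

definition sqfree_exp :: "nat set \<Rightarrow> nat \<Rightarrow>\<^sub>0 nat" where
  "sqfree_exp U = (\<Sum>a\<in>U. Poly_Mapping.single a 1)"

lemma lookup_sqfree_exp:
  "finite U \<Longrightarrow> Poly_Mapping.lookup (sqfree_exp U) a = (if a \<in> U then 1 else 0)"
  by (auto simp: sqfree_exp_def lookup_sum lookup_single when_def)

lemma keys_sqfree_exp: "finite U \<Longrightarrow> Poly_Mapping.keys (sqfree_exp U) = U"
  by (auto simp: in_keys_iff lookup_sqfree_exp split: if_splits)

lemma monomial_degree_sqfree_exp: "finite U \<Longrightarrow> monomial_degree (sqfree_exp U) = card U"
  by (simp add: monomial_degree_def keys_sqfree_exp lookup_sqfree_exp)

lemma mon_ideal_pcarrier: "mon_ideal n P \<subseteq> pcarrier n"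
  by (auto simp: mon_ideal_def pcarrier_eq intro: supp_in_mono)

lemma mon_ideal_Int: "mon_ideal n P \<inter> mon_ideal n Q = mon_ideal n (\<lambda>W. P W \<and> Q W)"
  by (auto simp: mon_ideal_def supp_in_def)

text \<open>Each monomial of \<open>f\<close> is assigned to a summand according to whether its
  support satisfies \<open>P\<close>.\<close>

lemma mon_ideal_sum:
  "mon_ideal n (\<lambda>W. P W \<or> Q W) = {f + g |f g. f \<in> mon_ideal n P \<and> g \<in> mon_ideal n Q}"
proof (intro equalityI subsetI)
  fix f :: "'a mpoly" assume f: "f \<in> mon_ideal n (\<lambda>W. P W \<or> Q W)"
  let ?S = "{m. P (Poly_Mapping.keys m)}"
  have "f = restr ?S f + restr (- ?S) f" by (rule restr_split)
  moreover have "restr ?S f \<in> mon_ideal n P" "restr (- ?S) f \<in> mon_ideal n Q"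
    using f by (auto simp: mon_ideal_def supp_in_def keys_restr)
  ultimately show "f \<in> {f + g |f g. f \<in> mon_ideal n P \<and> g \<in> mon_ideal n Q}" by blast
next
  fix h :: "'a mpoly" assume "h \<in> {f + g |f g. f \<in> mon_ideal n P \<and> g \<in> mon_ideal n Q}"
  then obtain f g where "h = f + g" "f \<in> mon_ideal n P" "g \<in> mon_ideal n Q" by blast
  then show "h \<in> mon_ideal n (\<lambda>W. P W \<or> Q W)"
    unfolding mon_ideal_def by (auto intro!: supp_in_add intro: supp_in_mono)
qed

text \<open>\<open>P\<close> ignores the variables in \<open>U\<close>, so it survives the division
  by x_U even when some of them leave the support.\<close>

lemma mon_ideal_mult:
  assumes fin: "finite U" and U: "U \<subseteq> {1..n}" and P: "\<And>W. P (U \<union> W) \<longleftrightarrow> P W"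
  shows "(*) (Poly_Mapping.single (sqfree_exp U) 1) ` mon_ideal n P
    = (mon_ideal n (\<lambda>W. U \<subseteq> W \<and> P W) :: ('k::field) mpoly set)"
proof (intro equalityI subsetI)
  fix f :: "'k mpoly" assume "f \<in> (*) (Poly_Mapping.single (sqfree_exp U) 1) ` mon_ideal n P"
  then obtain g where g: "g \<in> mon_ideal n P" and f: "f = Poly_Mapping.single (sqfree_exp U) 1 * g" by blast
  show "f \<in> mon_ideal n (\<lambda>W. U \<subseteq> W \<and> P W)"
    unfolding f mon_ideal_def
    by (rule supp_in_mult[of _ "{sqfree_exp U}", OF _ g[unfolded mon_ideal_def]])
       (use U P in \<open>auto simp: keys_add_nat keys_sqfree_exp fin\<close>)
next
  fix f :: "'k mpoly" assume f: "f \<in> mon_ideal n (\<lambda>W. U \<subseteq> W \<and> P W)"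
  \<comment> \<open>Truncated subtraction of exponents is exact here since \<open>U\<close> lies in
    the support of every monomial of \<open>f\<close>.\<close>
  define g where "g = (\<Sum>m\<in>Poly_Mapping.keys f. Poly_Mapping.single (m - sqfree_exp U) (Poly_Mapping.lookup f m))"
  have m: "sqfree_exp U + (m - sqfree_exp U) = m" "Poly_Mapping.keys (m - sqfree_exp U) \<subseteq> {1..n}"
    "P (Poly_Mapping.keys (m - sqfree_exp U))" if "m \<in> Poly_Mapping.keys f" for m
  proof -
    have m: "Poly_Mapping.keys m \<subseteq> {1..n}" "U \<subseteq> Poly_Mapping.keys m" "P (Poly_Mapping.keys m)"
      using f that by (auto simp: mon_ideal_def supp_in_def)
    show 1: "sqfree_exp U + (m - sqfree_exp U) = m"
      using m(2) by (intro poly_mapping_eqI) (auto simp: lookup_add lookup_minus lookup_sqfree_exp fin in_keys_iff Suc_le_eq)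
    have k: "Poly_Mapping.keys m = U \<union> Poly_Mapping.keys (m - sqfree_exp U)"
      using keys_add_nat[of "sqfree_exp U" "m - sqfree_exp U"] by (simp add: 1 keys_sqfree_exp fin)
    show "Poly_Mapping.keys (m - sqfree_exp U) \<subseteq> {1..n}"
      using m(1) k by blast
    show "P (Poly_Mapping.keys (m - sqfree_exp U))"
      using m(3) P[of "Poly_Mapping.keys (m - sqfree_exp U)"] k by simp
  qed
  have "Poly_Mapping.single (sqfree_exp U) 1 * g = (\<Sum>m\<in>Poly_Mapping.keys f. Poly_Mapping.single m (Poly_Mapping.lookup f m))"
    unfolding g_def sum_distrib_left mult_single by (rule sum.cong) (simp_all add: m(1))
  then have "f = Poly_Mapping.single (sqfree_exp U) 1 * g"
    by (simp flip: poly_expand)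
  moreover have "g \<in> mon_ideal n P"
    unfolding g_def mon_ideal_def by (rule supp_in_sum) (use m(2,3) in simp)
  ultimately show "f \<in> (*) (Poly_Mapping.single (sqfree_exp U) 1) ` mon_ideal n P" by blast
qed

lemma has_res_mon_ideal_mult:
  assumes "has_res n (mon_ideal n P :: ('k::field) mpoly set) c"
    and "finite U" "U \<subseteq> {1..n}" "\<And>W. P (U \<union> W) \<longleftrightarrow> P W"
  shows "has_res n (mon_ideal n (\<lambda>W. U \<subseteq> W \<and> P W) :: 'k mpoly set) (\<lambda>p q. c p (q - int (card U)))"
  using has_res_monomial_mult[OF assms(1) _ mon_ideal_pcarrier, of "sqfree_exp U"] assms(3)
  unfolding keys_sqfree_exp[OF assms(2)] monomial_degree_sqfree_exp[OF assms(2)] mon_ideal_mult[where P = P, OF assms(2-4)] .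

text \<open>Vertices are removed by dropping edges while all \<open>n\<close> variables stay, since
  isolated vertices impose no condition on covers. For a graph the hypotheses make \<open>N\<close>
  the neighbourhood of \<open>x\<close>, so the edges disjoint from \<open>N\<close> avoid
  \<open>x\<close> too and form G - N[x].\<close>

lemma has_res_vertex_split:
  assumes x: "x \<in> {1..n}" "x \<notin> N" and N: "N \<subseteq> {1..n}" "\<And>y. y \<in> N \<Longrightarrow> {x, y} \<in> E"
    and E: "\<And>e. e \<in> E \<Longrightarrow> x \<in> e \<Longrightarrow> e \<inter> N \<noteq> {}"
    and c1: "has_res n (mon_ideal n (covers {e \<in> E. x \<notin> e}) :: ('k::field) mpoly set) c1"
    and c2: "has_res n (mon_ideal n (covers {e \<in> E. e \<inter> N = {}}) :: 'k mpoly set) c2"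
  shows "has_res n (mon_ideal n (covers E) :: 'k mpoly set)
    (\<lambda>p q. c1 p (q - 1) + c2 p (q - int (card N))
       + (if p = 0 then 0 else c2 (p - 1) (q - int (card N) - 1)))"
proof -
  let ?P = "\<lambda>W. {x} \<subseteq> W \<and> covers {e \<in> E. x \<notin> e} W"
  let ?Q = "\<lambda>W. N \<subseteq> W \<and> covers {e \<in> E. e \<inter> N = {}} W"
  let ?R = "\<lambda>W. insert x N \<subseteq> W \<and> covers {e \<in> E. e \<inter> N = {}} W"
  have fin: "finite N" using N(1) finite_subset by blast
  have P: "has_res n (mon_ideal n ?P :: 'k mpoly set) (\<lambda>p q. c1 p (q - int (card {x})))"
    by (rule has_res_mon_ideal_mult[OF c1]) (use x in \<open>auto simp: covers_def\<close>)
  have Q: "has_res n (mon_ideal n ?Q :: 'k mpoly set) (\<lambda>p q. c2 p (q - int (card N)))"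
    by (rule has_res_mon_ideal_mult[OF c2]) (use N(1) fin in \<open>auto simp: covers_def Int_Un_distrib2\<close>)
  have eN: "(insert x N \<union> W) \<inter> e = W \<inter> e" if "e \<in> E" "e \<inter> N = {}" for W e
    using E[OF that(1)] that(2) by blast
  have R: "has_res n (mon_ideal n ?R :: 'k mpoly set) (\<lambda>p q. c2 p (q - int (card (insert x N))))"
    by (rule has_res_mon_ideal_mult[OF c2]) (use N(1) x fin eN in \<open>auto simp: covers_def\<close>)
  \<comment> \<open>An edge that meets \<open>N\<close> is covered by \<open>N\<close>, any other
    edge belongs to the smaller graph. Hence in the intersection the cover condition of
    \<open>?P\<close> is automatic.\<close>
  have Q_imp: "covers E W" "covers {e \<in> E. x \<notin> e} W" if "?Q W" for W
  proof -
    have "W \<inter> e \<noteq> {}" if "e \<in> E" for e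
      using \<open>?Q W\<close> that unfolding covers_def by (cases "e \<inter> N = {}") blast+
    then show "covers E W" "covers {e \<in> E. x \<notin> e} W"
      unfolding covers_def by blast+
  qed
  have PQ: "(\<lambda>W. ?P W \<or> ?Q W) = covers E"
  proof
    fix W
    have "?Q W" if "covers E W" "x \<notin> W"
    proof
      show "N \<subseteq> W"
      proof
        fix y assume "y \<in> N"
        then have "W \<inter> {x, y} \<noteq> {}"
          using N(2) that(1) unfolding covers_def by blast
        then show "y \<in> W" using that(2) by blast
      qed
    qed (use that(1) in \<open>simp add: covers_def\<close>)
    moreover have "?P W" if "covers E W" "x \<in> W"
      using that by (simp add: covers_def)
    moreover have "covers E W" if "?P W"
      using that unfolding covers_def by blast
    ultimately show "(?P W \<or> ?Q W) = covers E W"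
      using Q_imp(1) by blast
  qed
  have PR: "(\<lambda>W. ?P W \<and> ?Q W) = ?R"
  proof
    fix W
    show "(?P W \<and> ?Q W) = ?R W" using Q_imp(2)[of W] by blast
  qed
  have "has_res n (mon_ideal n ?P \<inter> mon_ideal n ?Q :: 'k mpoly set) (\<lambda>p q. c2 p (q - int (card N) - 1))"
    unfolding mon_ideal_Int PR using R by (simp add: x(2) fin algebra_simps)
  from has_res_sum[OF P Q this mon_ideal_pcarrier mon_ideal_pcarrier mon_ideal_sum]
  show ?thesis
    unfolding PQ by simp
qed

section \<open>Paths and cycles\<close>

text \<open>The vertices run from \<open>s\<close> to \<open>s + m - 1\<close>, so
  \<open>m = 0\<close> and \<open>m = 1\<close> give no edges. The start is a parameter because the
  cycle leaves paths beginning at 1 and at 2.\<close>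

definition path_edges :: "nat \<Rightarrow> nat \<Rightarrow> nat set set" where
  "path_edges s m = {{a, Suc a} |a. s \<le> a \<and> Suc a < s + m}"

text \<open>\<open>path_rank m p q\<close> is the number of basis elements of degree \<open>q\<close> in position \<open>p\<close> of the
  iterated mapping cone for the path on \<open>m\<close> vertices.\<close>

fun path_rank :: "nat \<Rightarrow> nat \<Rightarrow> int \<Rightarrow> nat" where
  "path_rank 0 p q = (if p = 0 \<and> q = 0 then 1 else 0)"
| "path_rank (Suc 0) p q = (if p = 0 \<and> q = 0 then 1 else 0)"
| "path_rank (Suc (Suc 0)) p q = path_rank 0 p (q - 1) + path_rank 0 p (q - 1)
     + (if p = 0 then 0 else path_rank 0 (p - 1) (q - 2))"
| "path_rank (Suc (Suc (Suc m))) p q = path_rank (Suc m) p (q - 1) + path_rank m p (q - 2)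
     + (if p = 0 then 0 else path_rank m (p - 1) (q - 3))"

lemma covers_empty: "mon_ideal n (covers {}) = pcarrier n"
  by (simp add: mon_ideal_def covers_def pcarrier_eq)

lemma has_res_no_edges:
  "has_res n (mon_ideal n (covers {}) :: ('k::field) mpoly set) (path_rank 0)"
proof -
  have "path_rank 0 = (\<lambda>p q. if p = 0 \<and> q = 0 then 1 else 0)" by (intro ext) simp
  then show ?thesis
    using has_res_pcarrier by (simp only: covers_empty)
qed

text \<open>The split is at the penultimate vertex: without it a path on \<open>m - 2\<close>
  vertices and an isolated end remain, without its closed neighbourhood a path on
  \<open>m - 3\<close>. On two vertices it has a single neighbour, whence the separate case.\<close>

lemma has_res_path:
  assumes "1 \<le> s" "s + m \<le> Suc n"
  shows "has_res n (mon_ideal n (covers (path_edges s m)) :: ('k::field) mpoly set) (path_rank m)"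
  using assms(2)
proof (induction m rule: less_induct)
  case (less m)
  consider "m = 0" | "m = 1" | "m = 2" | k where "m = Suc (Suc (Suc k))"
    by (metis One_nat_def Suc_1 not0_implies_Suc)
  then show ?case
  proof cases
    case 1
    then have "path_edges s m = {}" by (auto simp: path_edges_def)
    then show ?thesis using has_res_no_edges by (simp only: 1)
  next
    case 2
    then have "path_edges s m = {}" by (auto simp: path_edges_def)
    moreover have "path_rank 1 = path_rank 0" by (intro ext) simp
    ultimately show ?thesis using has_res_no_edges by (simp only: 2)
  next
    case 3
    have E: "path_edges s m = {{s, Suc s}}"
      using 3 by (auto simp: path_edges_def)
    have e: "{e \<in> path_edges s m. s \<notin> e} = {}" "{e \<in> path_edges s m. e \<inter> {Suc s} = {}} = {}"
      unfolding E by auto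
    have "has_res n (mon_ideal n (covers (path_edges s m)) :: 'k mpoly set)
      (\<lambda>p q. path_rank 0 p (q - 1) + path_rank 0 p (q - int (card {Suc s}))
        + (if p = 0 then 0 else path_rank 0 (p - 1) (q - int (card {Suc s}) - 1)))"
    proof (rule has_res_vertex_split[where x = s])
      show "has_res n (mon_ideal n (covers {e \<in> path_edges s m. s \<notin> e}) :: 'k mpoly set) (path_rank 0)"
        unfolding e by (rule has_res_no_edges)
      show "has_res n (mon_ideal n (covers {e \<in> path_edges s m. e \<inter> {Suc s} = {}}) :: 'k mpoly set) (path_rank 0)"
        unfolding e by (rule has_res_no_edges)
    qed (use assms(1) less.prems 3 in \<open>auto simp: E[unfolded 3]\<close>)
    moreover have "path_rank m = (\<lambda>p q. path_rank 0 p (q - 1) + path_rank 0 p (q - int (card {Suc s}))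
        + (if p = 0 then 0 else path_rank 0 (p - 1) (q - int (card {Suc s}) - 1)))"
      by (intro ext) (auto simp: 3 numeral_2_eq_2)
    ultimately show ?thesis by (simp only:)
  next
    case (4 k)
    let ?x = "Suc (s + k)" and ?N = "{s + k, Suc (Suc (s + k))}"
    have e1: "{e \<in> path_edges s m. ?x \<notin> e} = path_edges s (Suc k)"
      unfolding 4 path_edges_def by (auto simp: less_Suc_eq)
    have e2: "{e \<in> path_edges s m. e \<inter> ?N = {}} = path_edges s k"
      unfolding 4 path_edges_def by (auto simp: less_Suc_eq)
    have in_E: "{s + k, ?x} \<in> path_edges s m" "{?x, Suc ?x} \<in> path_edges s m"
      unfolding 4 path_edges_def
      by (intro CollectI exI[of _ "s + k"], simp) (intro CollectI exI[of _ ?x], simp)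
    have xE: "e \<inter> ?N \<noteq> {}" if "e \<in> path_edges s m" "?x \<in> e" for e
      using that by (auto simp: path_edges_def)
    have "has_res n (mon_ideal n (covers (path_edges s m)) :: 'k mpoly set)
      (\<lambda>p q. path_rank (Suc k) p (q - 1) + path_rank k p (q - int (card ?N))
        + (if p = 0 then 0 else path_rank k (p - 1) (q - int (card ?N) - 1)))"
    proof (rule has_res_vertex_split[where x = ?x])
      show "e \<inter> ?N \<noteq> {}" if "e \<in> path_edges s m" "?x \<in> e" for e
        by (rule xE[OF that])
      show "{?x, y} \<in> path_edges s m" if "y \<in> ?N" for y
        using that in_E by (auto simp: insert_commute)
      show "has_res n (mon_ideal n (covers {e \<in> path_edges s m. ?x \<notin> e}) :: 'k mpoly set) (path_rank (Suc k))"
        unfolding e1 using less.prems 4 by (intro less.IH) auto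
      show "has_res n (mon_ideal n (covers {e \<in> path_edges s m. e \<inter> ?N = {}}) :: 'k mpoly set) (path_rank k)"
        unfolding e2 using less.prems 4 by (intro less.IH) auto
      show "?x \<in> {1..n}" "?x \<notin> ?N" "?N \<subseteq> {1..n}"
        using assms(1) less.prems 4 by auto
    qed
    moreover have "path_rank m = (\<lambda>p q. path_rank (Suc k) p (q - 1) + path_rank k p (q - int (card ?N))
        + (if p = 0 then 0 else path_rank k (p - 1) (q - int (card ?N) - 1)))"
      by (intro ext) (auto simp: 4)
    ultimately show ?thesis by (simp only:)
  qed
qed

text \<open>The slopes 1/3 and 2/3 are those of the intersection term, which trades three vertices
  for one position and three degrees; the other two terms never exceed them. The constants are set
  by the paths on at most two vertices.\<close>

lemma path_rank_support:
  "path_rank m p q \<noteq> 0 \<Longrightarrow> 3 * p \<le> m + 1 \<and> 3 * (q - int p) \<le> 2 * int m \<and> 0 \<le> q \<and> q \<le> int m"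
proof (induction m p q rule: path_rank.induct)
  case (4 m p q)
  consider "path_rank (Suc m) p (q - 1) \<noteq> 0" | "path_rank m p (q - 2) \<noteq> 0"
    | "p \<noteq> 0" "path_rank m (p - 1) (q - 3) \<noteq> 0"
    using "4.prems" by (auto split: if_splits)
  then show ?case
  proof cases
    case 1 then show ?thesis using "4.IH"(1) by auto
  next
    case 2 then show ?thesis using "4.IH"(2) by auto
  next
    case 3 then show ?thesis using "4.IH"(3) by auto
  qed
qed (auto split: if_splits)

text \<open>By the bound on \<open>q\<close>, the first two terms of the recursion cannot reach
  degree \<open>m\<close>, so only the intersection term counts and the value is carried over from
  \<open>m - 3\<close>, one position up. On a single vertex nothing has degree 1, hence the zero
  residue class.\<close>

lemma path_rank_top:
  "path_rank m p (int m) = (if m mod 3 = 1 then 0 else if p = (m + 1) div 3 then 1 else 0)"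
proof (induction m arbitrary: p rule: less_induct)
  case (less m)
  consider "m = 0" | "m = 1" | "m = 2" | k where "m = Suc (Suc (Suc k))"
    by (metis One_nat_def Suc_1 not0_implies_Suc)
  then show ?case
  proof cases
    case 3
    then show ?thesis by (auto simp: numeral_2_eq_2)
  next
    case (4 k)
    have "path_rank (Suc k) p (int m - 1) = 0" "path_rank k p (int m - 2) = 0"
      using path_rank_support[of "Suc k" p "int m - 1"] path_rank_support[of k p "int m - 2"] 4 by auto
    then have "path_rank m p (int m) = (if p = 0 then 0 else path_rank k (p - 1) (int k))"
      by (simp add: 4)
    also have "\<dots> = (if p = 0 then 0 else if k mod 3 = 1 then 0 else if p - 1 = (k + 1) div 3 then 1 else 0)"
      using less.IH[of k "p - 1"] 4 by simp
    also have "\<dots> = (if m mod 3 = 1 then 0 else if p = (m + 1) div 3 then 1 else 0)"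
    proof -
      have "m mod 3 = k mod 3" "(m + 1) div 3 = Suc ((k + 1) div 3)"
        using 4 by presburger+
      then show ?thesis by auto
    qed
    finally show ?thesis .
  qed auto
qed

text \<open>The split at vertex \<open>n\<close> with neighbours 1 and n - 1: removing it leaves the
  path from 1 to n - 1, removing its closed neighbourhood the path from 2 to n - 2.\<close>

definition cycle_rank :: "nat \<Rightarrow> nat \<Rightarrow> int \<Rightarrow> nat" where
  "cycle_rank n p q = path_rank (n - 1) p (q - 1) + path_rank (n - 3) p (q - 2)
     + (if p = 0 then 0 else path_rank (n - 3) (p - 1) (q - 3))"

lemma has_res_cycle:
  assumes n: "n \<ge> 3"
  shows "has_res n (mon_ideal n (covers (cycle_edges n)) :: ('k::field) mpoly set) (cycle_rank n)"
proof -
  let ?N = "{1, n - 1}"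
  have e1: "{e \<in> cycle_edges n. n \<notin> e} = path_edges 1 (n - 1)"
    using n by (auto simp: cycle_edges_def path_edges_def)
  have e2: "{e \<in> cycle_edges n. e \<inter> ?N = {}} = path_edges 2 (n - 3)"
    using n by (auto simp: cycle_edges_def path_edges_def)
  have "{n - 1, Suc (n - 1)} \<in> cycle_edges n"
    unfolding cycle_edges_def using n by (intro UnI1 CollectI exI[of _ "n - 1"]) auto
  then have in_E: "{n, n - 1} \<in> cycle_edges n" "{n, 1} \<in> cycle_edges n"
    using n by (auto simp: cycle_edges_def insert_commute)
  have xE: "e \<inter> ?N \<noteq> {}" if "e \<in> cycle_edges n" "n \<in> e" for e
    using that by (auto simp: cycle_edges_def)
  have "has_res n (mon_ideal n (covers (cycle_edges n)) :: 'k mpoly set)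
    (\<lambda>p q. path_rank (n - 1) p (q - 1) + path_rank (n - 3) p (q - int (card ?N))
      + (if p = 0 then 0 else path_rank (n - 3) (p - 1) (q - int (card ?N) - 1)))"
  proof (rule has_res_vertex_split[where x = n])
    show "e \<inter> ?N \<noteq> {}" if "e \<in> cycle_edges n" "n \<in> e" for e
      by (rule xE[OF that])
    show "{n, y} \<in> cycle_edges n" if "y \<in> ?N" for y
      using that in_E by auto
    show "has_res n (mon_ideal n (covers {e \<in> cycle_edges n. n \<notin> e}) :: 'k mpoly set) (path_rank (n - 1))"
      unfolding e1 using n by (intro has_res_path) auto
    show "has_res n (mon_ideal n (covers {e \<in> cycle_edges n. e \<inter> ?N = {}}) :: 'k mpoly set) (path_rank (n - 3))"
      unfolding e2 using n by (intro has_res_path) auto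
  qed (use n in auto)
  moreover have "card ?N = 2" using n by simp
  then have "cycle_rank n = (\<lambda>p q. path_rank (n - 1) p (q - 1) + path_rank (n - 3) p (q - int (card ?N))
      + (if p = 0 then 0 else path_rank (n - 3) (p - 1) (q - int (card ?N) - 1)))"
    by (intro ext) (simp only: cycle_rank_def, simp)
  ultimately show ?thesis by (simp only:)
qed

text \<open>Both constants are the worst case over the three summands: 2 n + 1 is 2 (n - 1) + 3 from
  the path on n - 1 vertices with its shift by 1, and n + 1 is (n - 3) + 1 + 3 from the intersection
  term moved up one position.\<close>

lemma cycle_rank_support:
  assumes n: "n \<ge> 3" and nz: "cycle_rank n p q \<noteq> 0"
  shows "3 * p \<le> n + 1 \<and> 3 * (q - int p) \<le> 2 * int n + 1 \<and> 0 \<le> q \<and> q \<le> int n"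
proof -
  consider "path_rank (n - 1) p (q - 1) \<noteq> 0" | "path_rank (n - 3) p (q - 2) \<noteq> 0"
    | "p \<noteq> 0" "path_rank (n - 3) (p - 1) (q - 3) \<noteq> 0"
    using nz by (auto simp: cycle_rank_def split: if_splits)
  then show ?thesis
  proof cases
    case 1 from path_rank_support[OF 1] show ?thesis using n by (auto simp: of_nat_diff)
  next
    case 2 from path_rank_support[OF 2] show ?thesis using n by (auto simp: of_nat_diff)
  next
    case 3 from path_rank_support[OF 3(2)] 3(1) show ?thesis using n by (auto simp: of_nat_diff)
  qed
qed

text \<open>The path on n - 1 vertices contributes unless n mod 3 = 2, the intersection term unless
  n mod 3 = 1, and both do so in position (n + 1) div 3. For n divisible by 3 they coincide, which
  is the origin of the value 2.\<close>

lemma cycle_rank_top: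
  assumes n: "n \<ge> 3"
  shows "cycle_rank n p (int n) = (if p = (n + 1) div 3 then if n mod 3 = 0 then 2 else 1 else 0)"
proof -
  have middle: "path_rank (n - 3) p (int n - 2) = 0"
    using path_rank_support[of "n - 3" p "int n - 2"] n by (auto simp: of_nat_diff)
  have int_n: "int n - 1 = int (n - 1)" "int n - 3 = int (n - 3)"
    using n by auto
  have *: "cycle_rank n p (int n) = path_rank (n - 1) p (int (n - 1))
      + (if p = 0 then 0 else path_rank (n - 3) (p - 1) (int (n - 3)))"
    unfolding cycle_rank_def middle int_n by (simp only: add_0_right)
  define k where "k = n - 3"
  have n3: "n - 1 = k + 2" "n - 3 = k" "n = k + 3"
    using n by (auto simp: k_def)
  have "(n + 1) div 3 = Suc ((k + 1) div 3)" "(k + 2) mod 3 = 1 \<longleftrightarrow> n mod 3 = 2"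
    "k mod 3 = 1 \<longleftrightarrow> n mod 3 = 1" "n mod 3 \<noteq> 2 \<Longrightarrow> (k + 2 + 1) div 3 = (n + 1) div 3"
    "n mod 3 = 0 \<or> n mod 3 = 1 \<or> n mod 3 = 2"
    unfolding n3(3) by presburger+
  then show ?thesis
    unfolding * n3(1,2) path_rank_top by (cases p) auto
qed

section \<open>The vertex cover ideal\<close>

lemma prod_var: "finite U \<Longrightarrow> (\<Prod>a\<in>U. var a) = (Poly_Mapping.single (sqfree_exp U) 1 :: ('k::field) mpoly)"
  by (induction U rule: finite_induct) (simp_all add: sqfree_exp_def var_def mult_single)

lemma poly_ring_ops:
  "x \<oplus>\<^bsub>poly_ring n\<^esub> y = x + y" "x \<otimes>\<^bsub>poly_ring n\<^esub> y = x * y"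
  "\<zero>\<^bsub>poly_ring n\<^esub> = 0" "\<one>\<^bsub>poly_ring n\<^esub> = 1"
  by (simp_all add: poly_ring_def)

lemma cring_poly_ring: "cring (poly_ring n :: ('k::field) mpoly ring)"
proof (rule cringI)
  show "abelian_group (poly_ring n :: 'k mpoly ring)"
  proof (rule abelian_groupI)
    show "\<exists>y\<in>pcarrier n. y \<oplus>\<^bsub>poly_ring n\<^esub> x = \<zero>\<^bsub>poly_ring n\<^esub>"
      if "x \<in> pcarrier n" for x :: "'k mpoly"
      using pcarrier_uminus[OF that] by (intro bexI[of _ "- x"]) (simp_all add: poly_ring_ops)
  qed (simp_all add: poly_ring_ops pcarrier_add add_ac)
  show "comm_monoid (poly_ring n :: 'k mpoly ring)"
    by (rule comm_monoidI) (simp_all add: poly_ring_ops pcarrier_mult mult_ac)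
qed (simp add: poly_ring_ops distrib_right)

text \<open>Every generator is the monomial of a cover. Conversely the support of a monomial on the
  right contains a minimal cover, so the monomial is a multiple of a generator.\<close>

lemma cover_ideal_eq:
  assumes E: "\<And>e. e \<in> E \<Longrightarrow> e \<subseteq> {1..n}"
  shows "cover_ideal n E = (mon_ideal n (covers E) :: ('k::field) mpoly set)"
proof (intro equalityI)
  let ?S = "poly_ring n :: 'k mpoly ring"
  let ?G = "{\<Prod>a\<in>W. var a |W. minimal_vertex_cover n E W} :: 'k mpoly set"
  interpret S: cring ?S by (rule cring_poly_ring)
  note ops = poly_ring_ops
  have mult: "x * y \<in> mon_ideal n (covers E)"
    if "x \<in> mon_ideal n (covers E)" "y \<in> pcarrier n" for x y :: "'k mpoly"
    using that unfolding mon_ideal_def pcarrier_eq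
    by (rule supp_in_mult) (auto simp: keys_add_nat covers_def)
  have "ideal (mon_ideal n (covers E)) ?S"
  proof (rule idealI)
    show "ring ?S" by (rule S.ring_axioms)
    show "subgroup (mon_ideal n (covers E)) (add_monoid ?S)"
    proof (rule S.add.subgroupI)
      show "mon_ideal n (covers E) \<subseteq> carrier ?S" by (rule mon_ideal_pcarrier)
      show "mon_ideal n (covers E) \<noteq> ({} :: 'k mpoly set)"
        unfolding mon_ideal_def using supp_in_0 by blast
      fix a b :: "'k mpoly" assume a: "a \<in> mon_ideal n (covers E)"
      have "a \<in> carrier ?S" using a mon_ideal_pcarrier by blast
      then have "\<ominus>\<^bsub>?S\<^esub> a = - a"
        using S.minus_equality[of "- a" a] pcarrier_uminus[of a n] by (simp add: ops)
      then show "\<ominus>\<^bsub>?S\<^esub> a \<in> mon_ideal n (covers E)"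
        using a by (simp add: mon_ideal_def)
      assume "b \<in> mon_ideal n (covers E)"
      with a show "a \<oplus>\<^bsub>?S\<^esub> b \<in> mon_ideal n (covers E)"
        unfolding ops mon_ideal_def by (rule supp_in_add)
    qed
  qed (use mult in \<open>simp_all add: ops mult.commute\<close>)
  moreover have "?G \<subseteq> mon_ideal n (covers E)"
  proof
    fix f assume "f \<in> ?G"
    then obtain W where W: "f = (\<Prod>a\<in>W. var a)" "W \<subseteq> {1..n}" "covers E W"
      by (auto simp: minimal_vertex_cover_def vertex_cover_def covers_def)
    moreover have "finite W" using W(2) finite_subset by blast
    ultimately show "f \<in> mon_ideal n (covers E)"
      by (simp add: prod_var mon_ideal_def keys_sqfree_exp)
  qed
  ultimately show "cover_ideal n E \<subseteq> (mon_ideal n (covers E) :: 'k mpoly set)"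
    unfolding cover_ideal_def by (rule S.genideal_minimal)

  have G: "?G \<subseteq> carrier ?S"
    using \<open>?G \<subseteq> mon_ideal n (covers E)\<close> mon_ideal_pcarrier by blast
  have id: "ideal (cover_ideal n E) ?S"
    unfolding cover_ideal_def by (rule S.genideal_ideal[OF G])
  show "mon_ideal n (covers E) \<subseteq> (cover_ideal n E :: 'k mpoly set)"
  proof
    fix f :: "'k mpoly" assume f: "f \<in> mon_ideal n (covers E)"
    have mono: "Poly_Mapping.single m c \<in> (cover_ideal n E :: 'k mpoly set)"
      if m: "Poly_Mapping.keys m \<subseteq> {1..n}" "covers E (Poly_Mapping.keys m)" for m and c :: 'k
    proof -
      let ?A = "{W. W \<subseteq> Poly_Mapping.keys m \<and> vertex_cover n E W}"
      have fin: "finite ?A" by (rule finite_subset[of _ "Pow (Poly_Mapping.keys m)"]) auto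
      have "Poly_Mapping.keys m \<in> ?A"
        using m by (simp add: vertex_cover_def covers_def)
      from finite_has_minimal2[OF fin this]
      obtain W where W: "W \<in> ?A" and min: "\<forall>b\<in>?A. b \<subseteq> W \<longrightarrow> W = b" by (elim bexE conjE)
      \<comment> \<open>A cover inside \<open>W\<close> again lies in the support of
        \<open>m\<close>, so minimality within \<open>?A\<close> is minimality among all
        covers.\<close>
      have "W' = W" if "vertex_cover n E W'" "W' \<subseteq> W" for W'
      proof -
        have "W' \<in> ?A" using that W by (simp add: subset_trans[of W' W])
        with min that(2) have "W = W'" by blast
        then show ?thesis ..
      qed
      then have "minimal_vertex_cover n E W"
        using W by (simp add: minimal_vertex_cover_def)
      then have "(\<Prod>a\<in>W. var a) \<in> (cover_ideal n E :: 'k mpoly set)"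
        unfolding cover_ideal_def using S.genideal_self[OF G] by blast
      moreover have fW: "finite W" using W finite_subset[of W "Poly_Mapping.keys m"] by simp
      ultimately have "Poly_Mapping.single (sqfree_exp W) 1 \<in> (cover_ideal n E :: 'k mpoly set)"
        by (simp add: prod_var)
      moreover have eq: "sqfree_exp W + (m - sqfree_exp W) = m"
        using W by (intro poly_mapping_eqI) (auto simp: lookup_add lookup_minus lookup_sqfree_exp fW in_keys_iff Suc_le_eq)
      then have "Poly_Mapping.keys (m - sqfree_exp W) \<subseteq> {1..n}"
        using m(1) keys_add_nat[of "sqfree_exp W" "m - sqfree_exp W"] by auto
      then have "Poly_Mapping.single (m - sqfree_exp W) c \<in> pcarrier n"
        by (simp add: pcarrier_eq)
      ultimately have "Poly_Mapping.single (sqfree_exp W) 1 * Poly_Mapping.single (m - sqfree_exp W) c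
          \<in> (cover_ideal n E :: 'k mpoly set)"
        using ideal.I_r_closed[OF id] by (simp add: ops)
      then show ?thesis
        by (simp add: mult_single eq)
    qed
    have "0 \<in> (cover_ideal n E :: 'k mpoly set)"
      using additive_subgroup.zero_closed[OF ideal.axioms(1)[OF id]] by (simp add: ops)
    moreover have "a + b \<in> cover_ideal n E" if "a \<in> cover_ideal n E" "b \<in> cover_ideal n E" for a b :: "'k mpoly"
      using additive_subgroup.a_closed[OF ideal.axioms(1)[OF id] that] by (simp add: ops)
    ultimately have sum: "sum g A \<in> cover_ideal n E" if "\<And>i. i \<in> A \<Longrightarrow> g i \<in> cover_ideal n E"
      for A and g :: "(nat \<Rightarrow>\<^sub>0 nat) \<Rightarrow> 'k mpoly"
      using that by (induction A rule: infinite_finite_induct) auto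
    show "f \<in> cover_ideal n E"
      by (subst poly_expand, intro sum mono) (use f in \<open>auto simp: mon_ideal_def supp_in_def\<close>)
  qed
qed

text \<open>The support lies in the box p <= l, q - p <= r, and the elements of degree d = l + r sit
  at its corner. Alone in their degree they survive to Tor, and there they attain both bounds at
  once.\<close>

lemma invariants_from_support:
  fixes J :: "('k::field) mpoly set"
  assumes c: "has_res n J c" and J: "J \<subseteq> pcarrier n"
    and support: "\<And>p q. c p q \<noteq> 0 \<Longrightarrow> p \<le> l \<and> q - int p \<le> r \<and> 0 \<le> q \<and> q \<le> d"
    and top: "\<And>p. c p d = (if p = l then b else 0)" and b: "b \<noteq> 0" and d: "d = int l + r"
  shows "proj_dim n J = l" "regularity n J = r" "betti n J l d = b"
proof -
  have "betti n J l d = c l d"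
    by (rule betti_eq[OF c J]) (auto simp: top)
  then show betti: "betti n J l d = b"
    by (simp add: top)
  show "proj_dim n J = l"
  proof (rule proj_dim_eq[OF c J])
    show "c p q = 0" if "p > l" for p q
      using support[of p q] that by (cases "c p q = 0") simp_all
    show "betti n J l d \<noteq> 0" using betti b by simp
  qed
  have nz: "c p q \<noteq> 0" if "betti n J p q \<noteq> 0" for p q
    using betti_le[OF c J, of p q] that by simp
  let ?X = "{q - int p |p q. betti n J p q \<noteq> 0}"
  show "regularity n J = r"
    unfolding regularity_def
  proof (rule Max_eqI)
    show "finite ?X"
    proof (rule finite_subset)
      show "?X \<subseteq> (\<lambda>(p, q). q - int p) ` ({..l} \<times> {0..d})"
      proof
        fix y assume "y \<in> ?X"
        then obtain p q where "y = (\<lambda>(p, q). q - int p) (p, q)" "betti n J p q \<noteq> 0" by auto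
        then show "y \<in> (\<lambda>(p, q). q - int p) ` ({..l} \<times> {0..d})"
          using support[OF nz] by (intro image_eqI[of _ _ "(p, q)"]) simp_all
      qed
    qed simp
    show "y \<le> r" if y: "y \<in> ?X" for y
    proof -
      from y obtain p q where "y = q - int p" "betti n J p q \<noteq> 0" by auto
      then show ?thesis using support[OF nz] by simp
    qed
    show "r \<in> ?X"
      using betti b d by (intro CollectI exI[of _ l] exI[of _ d]) simp
  qed
qed

theorem theorem4p1:
  fixes n k i :: nat and j :: int and J :: "('k::field) mpoly set"
  assumes "n \<ge> 3" and "k \<ge> 1"
    and "J = cover_ideal n (cycle_edges n)"
    and "i = proj_dim n J" and "j = regularity n J"
  shows "(n = 3 * k \<longrightarrow>
            i = k \<and> j = 2 * int k \<and> betti n J k (int k + 2 * int k) = 2) \<and>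
         (n = 3 * k + 1 \<longrightarrow>
            i = k \<and> j = 2 * int k + 1 \<and> betti n J k (int k + (2 * int k + 1)) = 1) \<and>
         (n = 3 * k + 2 \<longrightarrow>
            i = k + 1 \<and> j = 2 * int k + 1 \<and>
            betti n J (k + 1) ((int k + 1) + (2 * int k + 1)) = 1)"
proof -
  have "e \<subseteq> {1..n}" if "e \<in> cycle_edges n" for e
    using that \<open>n \<ge> 3\<close> by (auto simp: cycle_edges_def)
  then have J: "J = mon_ideal n (covers (cycle_edges n))"
    unfolding assms(3) by (rule cover_ideal_eq)
  \<comment> \<open>The two inequalities say that \<open>r\<close> is the floor of (2 n + 1) / 3,
    the regularity bound of \<open>cycle_rank_support\<close>; that it also equals n - l is what
    places degree \<open>n\<close> at the corner, in each residue class modulo 3.\<close>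
  have inv: "i = l \<and> j = r \<and> betti n J l (int l + r) = b"
    if l: "l = (n + 1) div 3" and r: "r = int n - int l" "3 * r \<le> 2 * int n + 1" "2 * int n + 1 < 3 * r + 3"
      and b: "b = (if n mod 3 = 0 then 2 else 1)" for l r and b :: nat
  proof -
    have support: "p \<le> l \<and> q - int p \<le> r \<and> 0 \<le> q \<and> q \<le> int n" if "cycle_rank n p q \<noteq> 0" for p q
      using cycle_rank_support[OF \<open>n \<ge> 3\<close> that] l r by auto
    have top: "cycle_rank n p (int n) = (if p = l then b else 0)" for p
      unfolding cycle_rank_top[OF \<open>n \<ge> 3\<close>] l b by simp
    have "b \<noteq> 0" "int n = int l + r" using b r by simp_all
    note invariants_from_support[OF has_res_cycle[OF \<open>n \<ge> 3\<close>] mon_ideal_pcarrier support top this]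
    then show ?thesis
      using assms(4,5) r(1) by (simp add: J)
  qed
  have "i = k \<and> j = 2 * int k \<and> betti n J k (int k + 2 * int k) = 2" if "n = 3 * k"
    by (rule inv) (use that in auto)
  moreover have "i = k \<and> j = 2 * int k + 1 \<and> betti n J k (int k + (2 * int k + 1)) = 1" if "n = 3 * k + 1"
    by (rule inv) (use that in auto)
  moreover have "i = k + 1 \<and> j = 2 * int k + 1 \<and>
      betti n J (k + 1) (int (k + 1) + (2 * int k + 1)) = 1" if "n = 3 * k + 2"
    proof (rule inv)
    have "n mod 3 = 2" using that by presburger
    then show "1 = (if n mod 3 = 0 then 2 else 1 :: nat)" by simp
  qed (use that in auto)
  ultimately show ?thesis
    unfolding of_nat_add of_nat_1 by blast
qed

end
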